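(* Let $\mathcal{M}$ be a natural exponential family of order $d$ on $\mathbb{R}^d$, let $\Theta\subseteq\mathbb{R}^d$ be its natural parameter space, and let $f:\Theta\to\Xi$ be the reparameterisation map to the expectation parameter space. Let $H_s$ be the Edgeworth function of $\mathcal{M}$ of order $s$, where $s\ge0$ is an integer. Then $$H_s(f(\theta),f(\theta))=\sum_{i=0}^sF_i(\theta)n^{-i}$$ for any $\theta\in\Theta$, where each $F_i(\theta)$ is a function of $\theta$ but not of $n$. In particular $F_0(\theta)=1$, $$F_1(\theta)=\frac18\sum_{i_1,\dots,i_4}\kappa_{i_1\dots i_4}g^{i_1i_2}g^{i_3i_4}-\frac18\sum_{i_1,\dots,i_6}\kappa_{i_1i_2i_3}\kappa_{i_4i_5i_6}g^{i_1i_2}g^{i_3i_4}g^{i_5i_6}-\frac1{12}\sum_{i_1,\dots,i_6}\kappa_{i_1i_2i_3}\kappa_{i_4i_5i_6}g^{i_1i_4}g^{i_2i_5}g^{i_3i_6}$$ and $$\begin{aligned}F_2(\theta)=&\ \frac1{720}\sum_{i_1,\dots,i_6}\kappa_{i_1\dots i_6}h_{i_1\dots i_6}+\frac1{720}\sum_{i_1,\dots,i_8}\kappa_{i_1i_2i_3}\kappa_{i_4\dots i_8}h_{i_1\dots i_8}+\frac1{1152}\sum_{i_1,\dots,i_8}\kappa_{i_1\dots i_4}\kappa_{i_5\dots i_8}h_{i_1\dots i_8}\\&+\frac1{1728}\sum_{i_1,\dots,i_{10}}\kappa_{i_1i_2i_3}\kappa_{i_4i_5i_6}\kappa_{i_7\dots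 i_{10}}h_{i_1\dots i_{10}}+\frac1{31104}\sum_{i_1,\dots,i_{12}}\kappa_{i_1i_2i_3}\kappa_{i_4i_5i_6}\kappa_{i_7i_8i_9}\kappa_{i_{10}i_{11}i_{12}}h_{i_1\dots i_{12}},\end{aligned}$$ where every index $i_k$ ranges from $1$ to $d$ in each sum, and where, for $r=2k$ an even positive integer, $$h_{i_1\dots i_r}=\frac{(-1)^k}{k!}\,\frac{\partial^r}{\partial z_{i_1}\cdots\partial z_{i_r}}\left[\Big(\sum_{a,b=1}^dg^{ab}z_az_b/2\Big)^k\right].$$
   Context: Natural exponential family in natural parameterisation: $\Theta\subseteq\mathbb{R}^d$ is open, and $\mathcal{M}=\{e^{x\cdot\theta-\psi(\theta)}\mu_1:\theta\in\Theta\}$ is a set of probability measures on $\mathbb{R}^d$, where $\mu_1$ is a fixed measure on $\mathbb{R}^d$ and $\psi:\Theta\to\mathbb{R}$ is the log-partition function, determined by normalisation. "Order $d$" means the family is minimal: $\mu_1$ is not supported on a proper affine subspace of $\mathbb{R}^d$. Standing assumption: every $Q\in\mathcal{M}$ satisfies Cramér's condition $\limsup_{\|z\|\to\infty}|\hat Q(z)|<1$, where $\hat Q$ is its characteristic function. $\Xi$ is the set of means of members of $\mathcal{M}$, and $f(\theta)$ is the mean of $e^{x\cdot\theta-\psi(\theta)}\mu_1$. The cumulants of the distribution with parameter $\theta$ are $\kappa_{i_1\dots i_r}=\frac{\partial^r\psi}{\partial\theta_{i_1}\cdots\partial\theta_{i_r}}(\theta)$. The (scaled, one-observation) Fisher information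 metric is $g_\Theta(\theta)=\big(\partial^2\psi/\partial\theta_i\partial\theta_j\big)_{ij}$, and $g^{ij}=(g_\Theta(\theta)^{-1})_{ij}$. Edgeworth function $H_s:\Xi\times\Xi\to\mathbb{R}$ (depends on the sample size $n$): fix $\xi\in\Xi$, let $\kappa_{i_1\dots i_r}$ be the cumulants and $\Sigma$ the covariance matrix of the member of $\mathcal{M}$ with mean $\xi$, and let $\phi$ be the density of $N_d(0,\Sigma)$. For a multi-index $\alpha$ define the Hermite polynomial $h_\alpha(z)$ by $h_\alpha(z)\phi(z)=(-1)^{|\alpha|}\partial_z^\alpha\phi(z)$. Put $T_r(t)=\frac1{r!}\sum_{i_1,\dots,i_r=1}^d\kappa_{i_1\dots i_r}t_{i_1}\cdots t_{i_r}$ and expand formally $\exp\big(\sum_{r\ge3}T_r(t)n^{1-r/2}\big)=\sum_{j\ge0}n^{-j/2}Q_j(t)$ with $Q_j$ polynomials in $t$ not depending on $n$. Let $S_{j/2}(z)$ be obtained from $Q_j(t)$ by replacing each monomial $t^\alpha$ by $h_\alpha(z)$. Then $$H_s(x,\xi)=\sum_{j=0}^{2s}n^{-j/2}S_{j/2}\big(\sqrt n\,(x-\xi)\big).$$ (Equivalently, $H_s(x,\xi)$ times the density of $N_d(\xi,\Sigma/n)$ is the order-$s$ Edgeworth approximation, with error $o(n^{-s})$ on suitable Borel sets, to the law of the sample mean of $n$ IID observations from the member of $\mathcal{M}$ with mean $\xi$.) *)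

theory Defs
  imports
    "HOL-Probability.Probability"
    "HOL-Computational_Algebra.Formal_Power_Series"
    "HOL-Library.Poly_Mapping"
    "HOL-Library.Multiset"
begin

definition partial_deriv :: "'d::finite \<Rightarrow> (real^'d \<Rightarrow> real) \<Rightarrow> real^'d \<Rightarrow> real" where
  "partial_deriv i F z = deriv (\<lambda>t. F (z + t *\<^sub>R axis i 1)) 0"

primrec partial_derivs :: "'d::finite list \<Rightarrow> (real^'d \<Rightarrow> real) \<Rightarrow> real^'d \<Rightarrow> real" where
  "partial_derivs [] F = F"
| "partial_derivs (i # is) F = partial_deriv i (partial_derivs is F)"

definition log_partition :: "(real^'d) measure \<Rightarrow> real^'d \<Rightarrow> real" where
  "log_partition \<mu> \<theta> = ln (\<integral>x. exp (x \<bullet> \<theta>) \<partial>\<mu>)"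

definition nef_member :: "(real^'d) measure \<Rightarrow> real^'d \<Rightarrow> (real^'d) measure" where
  "nef_member \<mu> \<theta> = density \<mu> (\<lambda>x. ennreal (exp (x \<bullet> \<theta> - log_partition \<mu> \<theta>)))"

text \<open>
  If the integral defining the partition function diverges at some \<open>\<theta>\<close>, the Bochner integral
  and hence \<^const>\<open>log_partition\<close> is \<open>0\<close> there, and \<^const>\<open>nef_member\<close> is not a probability
  measure; so the last condition below forces the partition function to be finite on \<open>\<Theta>\<close>.
\<close>

definition natural_exponential_family :: "(real^'d) measure \<Rightarrow> (real^'d) set \<Rightarrow> bool" where
  "natural_exponential_family \<mu> \<Theta> \<longleftrightarrow>
     sets \<mu> = sets borel \<and> open \<Theta> \<and> (\<forall>\<theta>\<in>\<Theta>. prob_space (nef_member \<mu> \<theta>))"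

text \<open>The family is of order \<open>d\<close> if it is minimal.\<close>

definition full_order :: "(real^'d) measure \<Rightarrow> bool" where
  "full_order \<mu> \<longleftrightarrow> \<not> (\<exists>A. affine A \<and> A \<noteq> UNIV \<and> (AE x in \<mu>. x \<in> A))"

definition char_fun :: "(real^'d) measure \<Rightarrow> real^'d \<Rightarrow> complex" where
  "char_fun Q z = (\<integral>x. exp (\<i> * complex_of_real (z \<bullet> x)) \<partial>Q)"

definition cramer_condition :: "(real^'d) measure \<Rightarrow> bool" where
  "cramer_condition Q \<longleftrightarrow> Limsup at_infinity (\<lambda>z. ereal (cmod (char_fun Q z))) < 1"

definition mean :: "(real^'d) measure \<Rightarrow> real^'d" where
  "mean Q = (\<integral>x. x \<partial>Q)"

definition covariance_matrix :: "(real^'d) measure \<Rightarrow> real^'d^'d" where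
  "covariance_matrix Q = (\<chi> i j. \<integral>x. (x $ i - mean Q $ i) * (x $ j - mean Q $ j) \<partial>Q)"

text \<open>The reparameterisation map \<open>f\<close> from the natural to the expectation parameter.\<close>

definition nef_mean :: "(real^'d) measure \<Rightarrow> real^'d \<Rightarrow> real^'d" where
  "nef_mean \<mu> \<theta> = mean (nef_member \<mu> \<theta>)"

text \<open>Well defined on the means of the members when the family is minimal: the mean map is then injective.\<close>

definition nef_param :: "(real^'d) measure \<Rightarrow> (real^'d) set \<Rightarrow> real^'d \<Rightarrow> real^'d" where
  "nef_param \<mu> \<Theta> \<xi> = (THE \<theta>. \<theta> \<in> \<Theta> \<and> nef_mean \<mu> \<theta> = \<xi>)"

definition cumulant :: "(real^'d) measure \<Rightarrow> real^'d \<Rightarrow> 'd::finite list \<Rightarrow> real" where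
  "cumulant \<mu> \<theta> is = partial_derivs is (log_partition \<mu>) \<theta>"

definition fisher_metric :: "(real^'d) measure \<Rightarrow> real^'d \<Rightarrow> real^'d^'d" where
  "fisher_metric \<mu> \<theta> = (\<chi> i j. partial_derivs [i, j] (log_partition \<mu>) \<theta>)"

definition fisher_inv :: "(real^'d) measure \<Rightarrow> real^'d \<Rightarrow> 'd::finite \<Rightarrow> 'd \<Rightarrow> real" where
  "fisher_inv \<mu> \<theta> i j = matrix_inv (fisher_metric \<mu> \<theta>) $ i $ j"

definition normal_density_vec :: "real^'d^'d \<Rightarrow> real^'d \<Rightarrow> real" where
  "normal_density_vec \<Sigma> z =
     exp (- (z \<bullet> (matrix_inv \<Sigma> *v z)) / 2) / sqrt ((2 * pi) ^ CARD('d) * det \<Sigma>)"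

text \<open>
  A multi-index \<open>\<alpha>\<close> over the index set \<open>'d\<close> is a multiset \<open>\<alpha> :: 'd multiset\<close>: \<open>\<alpha>\<^sub>i\<close> is
  \<open>count \<alpha> i\<close> and \<open>|\<alpha>|\<close> is \<open>size \<alpha>\<close>. The derivative \<open>\<partial>\<^sup>\<alpha>\<close> is the iterated partial derivative
  along some enumeration of \<open>\<alpha>\<close>; the choice is immaterial for smooth functions.
\<close>

definition multi_deriv :: "'d multiset \<Rightarrow> (real^'d \<Rightarrow> real) \<Rightarrow> real^'d::finite \<Rightarrow> real" where
  "multi_deriv \<alpha> F = partial_derivs (SOME is. mset is = \<alpha>) F"

definition hermite :: "real^'d^'d \<Rightarrow> 'd::finite multiset \<Rightarrow> real^'d \<Rightarrow> real" where
  "hermite \<Sigma> \<alpha> z =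
     (-1) ^ size \<alpha> * multi_deriv \<alpha> (normal_density_vec \<Sigma>) z / normal_density_vec \<Sigma> z"

text \<open>
  Real polynomials in the variables \<open>t\<^sub>i\<close>, \<open>i :: 'd\<close>: finitely supported coefficient functions on
  multi-indices, with the convolution product. The monomial \<open>c t\<^sup>\<alpha>\<close> is
  \<open>Poly_Mapping.single \<alpha> c\<close>.
\<close>

type_synonym 'd polynomial = "'d multiset \<Rightarrow>\<^sub>0 real"

definition cumulant_poly :: "('d::finite list \<Rightarrow> real) \<Rightarrow> nat \<Rightarrow> 'd polynomial" where
  "cumulant_poly \<kappa> r =
     Poly_Mapping.single {#} (1 / fact r) *
     (\<Sum>is | length is = r. Poly_Mapping.single (mset is) (\<kappa> is))"

text \<open>
  The formal expansion is carried out in the power series variable \<open>\<epsilon> = n\<^sup>-\<^sup>1\<^sup>/\<^sup>2\<close>, in which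
  \<open>n\<^bsup>1-r/2\<^esup> = \<epsilon>\<^bsup>r-2\<^esup>\<close>. The exponential is the composition with \<open>\<Sum>\<^sub>m X\<^sup>m / m!\<close>
  (the constant \<open>fps_exp\<close> requires a coefficient field).
\<close>

definition edgeworth_exponent :: "('d::finite list \<Rightarrow> real) \<Rightarrow> 'd polynomial fps" where
  "edgeworth_exponent \<kappa> = Abs_fps (\<lambda>m. if m = 0 then 0 else cumulant_poly \<kappa> (m + 2))"

definition edgeworth_poly :: "('d::finite list \<Rightarrow> real) \<Rightarrow> nat \<Rightarrow> 'd polynomial" where
  "edgeworth_poly \<kappa> j =
     fps_nth (fps_compose (Abs_fps (\<lambda>m. Poly_Mapping.single {#} (1 / fact m)))
                          (edgeworth_exponent \<kappa>)) j"

text \<open>The function \<open>S\<^bsub>j/2\<^esub>\<close>, indexed here by \<open>j\<close>.\<close>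

definition edgeworth_term ::
    "('d::finite list \<Rightarrow> real) \<Rightarrow> real^'d^'d \<Rightarrow> nat \<Rightarrow> real^'d \<Rightarrow> real" where
  "edgeworth_term \<kappa> \<Sigma> j z =
     (\<Sum>\<alpha>\<in>Poly_Mapping.keys (edgeworth_poly \<kappa> j).
        Poly_Mapping.lookup (edgeworth_poly \<kappa> j) \<alpha> * hermite \<Sigma> \<alpha> z)"

definition edgeworth_function ::
    "(real^'d) measure \<Rightarrow> (real^'d) set \<Rightarrow> nat \<Rightarrow> nat \<Rightarrow> real^'d \<Rightarrow> real^'d::finite \<Rightarrow> real" where
  "edgeworth_function \<mu> \<Theta> s n x \<xi> =
     (let \<theta> = nef_param \<mu> \<Theta> \<xi>;
          \<kappa> = cumulant \<mu> \<theta>;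
          \<Sigma> = covariance_matrix (nef_member \<mu> \<theta>)
      in \<Sum>j = 0..2 * s. real n powr (- (real j / 2)) *
           edgeworth_term \<kappa> \<Sigma> j (sqrt (real n) *\<^sub>R (x - \<xi>)))"

text \<open>
  The coefficient \<open>h\<^bsub>i\<^sub>1\<dots>i\<^sub>r\<^esub>\<close> with \<open>r = 2k\<close>. The differentiated function is a homogeneous
  polynomial of degree \<open>r\<close>, so its \<open>r\<close>-th order derivative is constant and is evaluated at \<open>0\<close>.
\<close>

definition hermite_const :: "('d::finite \<Rightarrow> 'd \<Rightarrow> real) \<Rightarrow> 'd list \<Rightarrow> real" where
  "hermite_const g is =
     (let k = length is div 2
      in (-1) ^ k / fact k *
         partial_derivs is (\<lambda>z. (\<Sum>a\<in>UNIV. \<Sum>b\<in>UNIV. g a b * z $ a * z $ b / 2) ^ k) 0)"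

end

theory Submission
  imports Defs
begin

text \<open>
  At the mean every Hermite polynomial is evaluated at \<open>0\<close>. With \<open>q\<close> half the quadratic form of
  \<open>\<Sigma>\<^sup>-\<^sup>1\<close>, an iterated derivative of \<open>\<Phi> \<circ> q\<close> is a sum over partial matchings of the differentiation
  indices, and at \<open>0\<close> only the perfect matchings survive, with a weight \<open>\<Phi>\<^sup>(\<^sup>k\<^sup>)(0)\<close> for \<open>2k\<close> indices.
  Taking \<open>\<Phi> = exp (- x)\<close> and \<open>\<Phi> = x ^ k\<close> shows that Hermite values of odd degree vanish and that those
  of even degree are the coefficients \<open>h\<close>. All monomials of \<open>Q\<^sub>j\<close> have degree congruent to \<open>j\<close> modulo 2, so
  only even \<open>j\<close> contribute. Minimality makes the mean map injective and \<open>\<Sigma>\<close>, which is the Fisher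
  metric, invertible; the symmetry of the cumulants, which follows from the commutation of partial
  derivatives, collapses the fifteen pairings in \<open>F\<^sub>1\<close> to two sums.
\<close>

section \<open>Commuting partial derivatives\<close>

text \<open>The normalisation of \<open>hermite_const\<close> is the ratio of the two outer
  functions. For 2k indices the k-th derivative at 0 is (-1)^k times the Gaussian constant in one
  case and k! in the other, and the Gaussian constant cancels on division by the density. So (-1)^k
  / k! converts one into the other without evaluating the sum over perfect matchings, which is
  expanded only for four and six indices.

  The obstacle is the order of differentiation: \<open>multi_deriv\<close> follows an unspecified
  enumeration of a multiset, and \<open>partial_derivs\<close> iterates the one-variable
  \<open>deriv\<close>, with no notion of smoothness attached. An algebraic argument takes the place
  of Schwarz's theorem. Both functions concerned, the Gaussian density and the log-partition
  function, lie in an algebra whose generators have their partial derivatives in the algebra and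
  equal mixed second derivatives.\<close>

definition pdiff_on :: "(real^'d) set \<Rightarrow> 'd::finite \<Rightarrow> (real^'d \<Rightarrow> real) \<Rightarrow> (real^'d \<Rightarrow> real) \<Rightarrow> bool" where
  "pdiff_on U i F F' \<longleftrightarrow>
     (\<forall>z\<in>U. ((\<lambda>t. F (z + t *\<^sub>R axis i 1)) has_field_derivative F' z) (at 0))"

text \<open>\<open>deriv\<close> is unspecified where no derivative exists, so calculations carry an
  explicit derivative in \<open>pdiff_on\<close> and return to \<open>partial_deriv\<close> only
  here.\<close>

lemma pdiff_onD: "pdiff_on U i F F' \<Longrightarrow> z \<in> U \<Longrightarrow> partial_deriv i F z = F' z"
  by (auto simp: pdiff_on_def partial_deriv_def DERIV_imp_deriv)

lemma pdiff_on_const: "pdiff_on U i (\<lambda>_. c) (\<lambda>_. 0)"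
  by (simp add: pdiff_on_def)

lemma pdiff_on_add:
  "pdiff_on U i F F' \<Longrightarrow> pdiff_on U i G G' \<Longrightarrow> pdiff_on U i (\<lambda>z. F z + G z) (\<lambda>z. F' z + G' z)"
  by (auto simp: pdiff_on_def intro!: DERIV_add)

lemma pdiff_on_mult:
  assumes "pdiff_on U i F F'" "pdiff_on U i G G'"
  shows "pdiff_on U i (\<lambda>z. F z * G z) (\<lambda>z. F' z * G z + F z * G' z)"
  unfolding pdiff_on_def
proof
  fix z assume "z \<in> U"
  then show "((\<lambda>t. F (z + t *\<^sub>R axis i 1) * G (z + t *\<^sub>R axis i 1))
      has_field_derivative (F' z * G z + F z * G' z)) (at 0)"
    using assms unfolding pdiff_on_def
    by (auto intro!: derivative_eq_intros)
qed

lemma pdiff_on_comp: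
  assumes "pdiff_on U i F F'" "\<And>z. z \<in> U \<Longrightarrow> (f has_field_derivative f' (F z)) (at (F z))"
  shows "pdiff_on U i (\<lambda>z. f (F z)) (\<lambda>z. f' (F z) * F' z)"
  unfolding pdiff_on_def
proof
  fix z assume z: "z \<in> U"
  have "(f has_field_derivative f' (F z)) (at (F (z + 0 *\<^sub>R axis i 1)))"
    using assms(2)[OF z] by simp
  from DERIV_chain2[where g = "\<lambda>t. F (z + t *\<^sub>R axis i 1)" and x = 0, OF this] assms(1) z
  show "((\<lambda>t. f (F (z + t *\<^sub>R axis i 1))) has_field_derivative f' (F z) * F' z) (at 0)"
    unfolding pdiff_on_def by auto
qed

text \<open>Openness keeps a short axis-parallel segment around \<open>z\<close> inside
  \<open>U\<close>, so the two functions agree near \<open>t = 0\<close>.\<close>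

lemma partial_deriv_cong:
  assumes "open U" "\<And>z. z \<in> U \<Longrightarrow> F z = G z" "z \<in> U"
  shows "partial_deriv i F z = partial_deriv i G z"
proof -
  have "((\<lambda>t::real. z + t *\<^sub>R axis i 1) \<longlongrightarrow> z + 0 *\<^sub>R axis i 1) (nhds 0)"
    by (intro tendsto_intros filterlim_ident)
  then have "eventually (\<lambda>t::real. z + t *\<^sub>R axis i 1 \<in> U) (nhds 0)"
    using assms(1,3) by (auto dest: topological_tendstoD)
  then have "eventually (\<lambda>t. F (z + t *\<^sub>R axis i 1) = G (z + t *\<^sub>R axis i 1)) (nhds 0)"
    by eventually_elim (use assms(2) in auto)
  then show ?thesis
    unfolding partial_deriv_def by (intro deriv_cong_ev) auto
qed

lemma partial_derivs_cong:
  assumes "open U" "\<And>z. z \<in> U \<Longrightarrow> F z = G z" "z \<in> U"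
  shows "partial_derivs is F z = partial_derivs is G z"
  using assms(3)
  by (induction "is" arbitrary: z) (auto intro!: partial_deriv_cong[OF assms(1)] simp: assms(2))

section \<open>Algebras of functions generated by a set\<close>

inductive fun_alg :: "(real^'d \<Rightarrow> real) set \<Rightarrow> (real^'d \<Rightarrow> real) \<Rightarrow> bool" for S where
  gen: "g \<in> S \<Longrightarrow> fun_alg S g"
| const: "fun_alg S (\<lambda>_. c)"
| add: "fun_alg S F \<Longrightarrow> fun_alg S G \<Longrightarrow> fun_alg S (\<lambda>z. F z + G z)"
| mult: "fun_alg S F \<Longrightarrow> fun_alg S G \<Longrightarrow> fun_alg S (\<lambda>z. F z * G z)"

text \<open>The single witness \<open>Fij\<close> for both orders encodes at once that the mixed
  derivatives exist on \<open>U\<close> and that they coincide.\<close>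

definition commuting_partials :: "(real^'d) set \<Rightarrow> 'd::finite \<Rightarrow> 'd \<Rightarrow> (real^'d \<Rightarrow> real) \<Rightarrow> bool" where
  "commuting_partials U i j F \<longleftrightarrow> (\<exists>Fi Fj Fij. pdiff_on U i F Fi \<and> pdiff_on U j F Fj \<and>
      pdiff_on U j Fi Fij \<and> pdiff_on U i Fj Fij)"

lemma commuting_partialsI:
  "pdiff_on U i F Fi \<Longrightarrow> pdiff_on U j F Fj \<Longrightarrow> pdiff_on U j Fi Fij \<Longrightarrow> pdiff_on U i Fj Fij \<Longrightarrow>
    commuting_partials U i j F"
  unfolding commuting_partials_def by blast

lemma commuting_partialsD:
  assumes "open U" "commuting_partials U i j F" "z \<in> U"
  shows "partial_deriv i (partial_deriv j F) z = partial_deriv j (partial_deriv i F) z"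
proof -
  obtain Fi Fj Fij where *: "pdiff_on U i F Fi" "pdiff_on U j F Fj"
      "pdiff_on U j Fi Fij" "pdiff_on U i Fj Fij"
    using assms(2) unfolding commuting_partials_def by blast
  have "partial_deriv i (partial_deriv j F) z = partial_deriv i Fj z"
    using assms * by (intro partial_deriv_cong[of U]) (auto dest: pdiff_onD)
  moreover have "partial_deriv j (partial_deriv i F) z = partial_deriv j Fi z"
    using assms * by (intro partial_deriv_cong[of U]) (auto dest: pdiff_onD)
  ultimately show ?thesis
    using *(3,4)[THEN pdiff_onD, OF assms(3)] by simp
qed

text \<open>The commutator of two derivations is a derivation, so it vanishes on an algebra as soon as
  it vanishes on generators.\<close>

lemma fun_alg_commuting_partials:
  assumes "fun_alg S F" "\<And>g. g \<in> S \<Longrightarrow> commuting_partials U i j g"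
  shows "commuting_partials U i j F"
  using assms(1)
proof induction
  case (gen g)
  then show ?case by (rule assms(2))
next
  case (const c)
  then show ?case
    unfolding commuting_partials_def using pdiff_on_const by blast
next
  case (add F G)
  obtain Fi Fj Fij where F: "pdiff_on U i F Fi" "pdiff_on U j F Fj"
      "pdiff_on U j Fi Fij" "pdiff_on U i Fj Fij"
    using add.IH(1) unfolding commuting_partials_def by blast
  obtain Gi Gj Gij where G: "pdiff_on U i G Gi" "pdiff_on U j G Gj"
      "pdiff_on U j Gi Gij" "pdiff_on U i Gj Gij"
    using add.IH(2) unfolding commuting_partials_def by blast
  show ?case
    unfolding commuting_partials_def using F G pdiff_on_add by blast
next
  case (mult F G)
  obtain Fi Fj Fij where F: "pdiff_on U i F Fi" "pdiff_on U j F Fj"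
      "pdiff_on U j Fi Fij" "pdiff_on U i Fj Fij"
    using mult.IH(1) unfolding commuting_partials_def by blast
  obtain Gi Gj Gij where G: "pdiff_on U i G Gi" "pdiff_on U j G Gj"
      "pdiff_on U j Gi Gij" "pdiff_on U i Gj Gij"
    using mult.IH(2) unfolding commuting_partials_def by blast
  let ?H = "\<lambda>z. (Fij z * G z + Fi z * Gj z) + (Fj z * Gi z + F z * Gij z)"
  have "pdiff_on U j (\<lambda>z. Fi z * G z + F z * Gi z) ?H"
    using F G by (intro pdiff_on_add pdiff_on_mult)
  moreover have "pdiff_on U i (\<lambda>z. Fj z * G z + F z * Gj z)
      (\<lambda>z. (Fij z * G z + Fj z * Gi z) + (Fi z * Gj z + F z * Gij z))"
    using F G by (intro pdiff_on_add pdiff_on_mult)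
  moreover have "(\<lambda>z. (Fij z * G z + Fj z * Gi z) + (Fi z * Gj z + F z * Gij z)) = ?H"
    by (auto simp: algebra_simps)
  ultimately show ?case
    unfolding commuting_partials_def
    by (intro exI[of _ "\<lambda>z. Fi z * G z + F z * Gi z"] exI[of _ "\<lambda>z. Fj z * G z + F z * Gj z"]
        exI[of _ ?H] conjI pdiff_on_mult F G) simp_all
qed

lemma fun_alg_pdiff_on:
  assumes "fun_alg S F" "\<And>g. g \<in> S \<Longrightarrow> \<exists>G. fun_alg S G \<and> pdiff_on U i g G"
  shows "\<exists>G. fun_alg S G \<and> pdiff_on U i F G"
  using assms(1)
proof induction
  case (gen g)
  then show ?case by (rule assms(2))
next
  case (const c)
  then show ?case using pdiff_on_const fun_alg.const by blast
next
  case (add F G)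
  then show ?case using pdiff_on_add fun_alg.add by blast
next
  case (mult F G)
  then obtain F' G' where "fun_alg S F'" "pdiff_on U i F F'" "fun_alg S G'" "pdiff_on U i G G'"
    by blast
  then show ?case
    using pdiff_on_mult[of U i F F' G G'] mult.hyps
    by (intro exI[of _ "\<lambda>z. F' z * G z + F z * G' z"]) (auto intro: fun_alg.add fun_alg.mult)
qed

text \<open>Agreement is claimed on \<open>U\<close> only, since nothing is known of the derivatives
  elsewhere; as \<open>U\<close> is open, the next derivative does not see the difference.\<close>

lemma partial_derivs_in_alg:
  assumes "open U" "fun_alg S F"
    and "\<And>g i. g \<in> S \<Longrightarrow> \<exists>G. fun_alg S G \<and> pdiff_on U i g G"
  shows "\<exists>G. fun_alg S G \<and> (\<forall>z\<in>U. partial_derivs is F z = G z)"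
proof (induction "is")
  case Nil
  then show ?case using assms(2) by auto
next
  case (Cons i "is")
  then obtain G where G: "fun_alg S G" "\<forall>z\<in>U. partial_derivs is F z = G z" by blast
  obtain G' where "fun_alg S G'" "pdiff_on U i G G'"
    using fun_alg_pdiff_on[OF G(1) assms(3)] by blast
  moreover have "partial_deriv i (partial_derivs is F) z = partial_deriv i G z" if "z \<in> U" for z
    using assms(1) G(2) that by (intro partial_deriv_cong[of U]) auto
  ultimately show ?case by (auto dest: pdiff_onD)
qed

text \<open>A permutation is a chain of adjacent swaps. A swap below further derivatives is
  justified because the function it acts on is, on \<open>U\<close>, again a member of the
  algebra.\<close>

lemma partial_derivs_mset_cong:
  assumes "open U" "fun_alg S F"
    and "\<And>g i. g \<in> S \<Longrightarrow> \<exists>G. fun_alg S G \<and> pdiff_on U i g G"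
    and "\<And>g i j. g \<in> S \<Longrightarrow> commuting_partials U i j g"
    and "mset is = mset js" "z \<in> U"
  shows "partial_derivs is F z = partial_derivs js F z"
proof -
  have swap: "partial_derivs (i # j # ks) F z = partial_derivs (j # i # ks) F z" if "z \<in> U" for i j ks z
  proof -
    obtain G where G: "fun_alg S G" "\<forall>z\<in>U. partial_derivs ks F z = G z"
      using partial_derivs_in_alg[OF assms(1-3)] by blast
    have *: "partial_derivs (k # l # ks) F z = partial_deriv k (partial_deriv l G) z" for k l
    proof -
      have "partial_derivs [k, l] (partial_derivs ks F) z = partial_derivs [k, l] G z"
        using assms(1) G(2) that by (intro partial_derivs_cong[of U]) auto
      then show ?thesis by simp
    qed
    have "commuting_partials U i j G"
      using G(1) assms(4) by (rule fun_alg_commuting_partials)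
    from commuting_partialsD[OF assms(1) this that] show ?thesis
      unfolding * .
  qed
  have cons: "partial_derivs (i # ks) F z = partial_derivs (i # ls) F z"
    if "\<And>z. z \<in> U \<Longrightarrow> partial_derivs ks F z = partial_derivs ls F z" "z \<in> U" for i ks ls z
    unfolding partial_derivs.simps using assms(1) that by (rule partial_deriv_cong)
  have move: "partial_derivs (i # ks @ ls) F z = partial_derivs (ks @ i # ls) F z"
    if "z \<in> U" for i ks ls z
    using that
  proof (induction ks arbitrary: z)
    case (Cons k ks)
    have "partial_derivs (i # k # ks @ ls) F z = partial_derivs (k # i # ks @ ls) F z"
      using swap Cons.prems .
    also have "\<dots> = partial_derivs (k # ks @ i # ls) F z"
      using Cons.IH Cons.prems by (rule cons)
    finally show ?case by simp
  qed simp
  show ?thesis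
    using assms(5,6)
  proof (induction "is" arbitrary: js z)
    case (Cons i "is")
    then have "i \<in> set js" by (metis list.set_intros(1) mset_eq_setD)
    then obtain ks ls where js: "js = ks @ i # ls" by (meson split_list)
    with Cons.prems have "mset is = mset (ks @ ls)" by simp
    then have "partial_derivs (i # is) F z = partial_derivs (i # ks @ ls) F z"
      using Cons.IH Cons.prems(2) by (intro cons)
    also have "\<dots> = partial_derivs js F z"
      using move Cons.prems(2) js by simp
    finally show ?case .
  qed simp
qed

section \<open>Derivatives of functions of a quadratic form\<close>

definition quad_half :: "real^'d^'d \<Rightarrow> real^'d::finite \<Rightarrow> real" where
  "quad_half A z = z \<bullet> (A *v z) / 2"

text \<open>The product rule for a product of linear forms: each entry drops one factor and records
  its constant derivative. The result is a list, so repeated indices are counted separately.\<close>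

fun strike :: "('d \<Rightarrow> 'd \<Rightarrow> real) \<Rightarrow> 'd \<Rightarrow> 'd list \<Rightarrow> (real \<times> 'd list) list" where
  "strike a i [] = []"
| "strike a i (u # us) = (a i u, us) # map (\<lambda>(c, vs). (c, u # vs)) (strike a i us)"

text \<open>An entry \<open>(c, us, m)\<close> of the list stands for the summand
  \<open>c * (\<Prod>u\<leftarrow>us. (A z)\<^sub>u) * \<Phi>\<^sup>(\<^sup>m\<^sup>)(q z)\<close> of an iterated derivative of \<open>\<Phi> \<circ> q\<close>: it collects a partial
  matching of the differentiation indices, whose unmatched indices are \<open>us\<close>.\<close>

primrec matchings :: "('d \<Rightarrow> 'd \<Rightarrow> real) \<Rightarrow> 'd list \<Rightarrow> (real \<times> 'd list \<times> nat) list" where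
  "matchings a [] = [(1, [], 0)]"
| "matchings a (i # is) = concat (map (\<lambda>(c, us, m).
     (c, i # us, Suc m) # map (\<lambda>(b, vs). (c * b, vs, m)) (strike a i us)) (matchings a is))"

text \<open>The sum over perfect matchings known from the Isserlis (Wick) formula.\<close>

definition pairings :: "('d \<Rightarrow> 'd \<Rightarrow> real) \<Rightarrow> 'd list \<Rightarrow> real" where
  "pairings a is = (\<Sum>(c, us, m)\<leftarrow>matchings a is. if us = [] then c else 0)"

lemma pdiff_on_sum_list:
  assumes "\<And>x. x \<in> set xs \<Longrightarrow> pdiff_on U i (F x) (F' x)"
  shows "pdiff_on U i (\<lambda>z. \<Sum>x\<leftarrow>xs. F x z) (\<lambda>z. \<Sum>x\<leftarrow>xs. F' x z)"
  using assms by (induction xs) (auto intro!: pdiff_on_add pdiff_on_const)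

lemma pdiff_on_lin: "pdiff_on U i (\<lambda>z. (A *v z) $ u) (\<lambda>_. A $ u $ i)"
  unfolding pdiff_on_def
  by (auto simp: matrix_vector_right_distrib matrix_vector_mult_scaleR matrix_vector_mul_component
        inner_axis inner_real_def intro!: derivative_eq_intros)

lemma pdiff_on_quad_half:
  assumes "transpose A = A"
  shows "pdiff_on U i (quad_half A) (\<lambda>z. (A *v z) $ i)"
  unfolding pdiff_on_def
proof
  fix z
  \<comment> \<open>The expansion in \<open>t\<close> is exact, and symmetry of \<open>A\<close>
    merges the two cross terms into the linear coefficient.\<close>
  have "quad_half A (z + t *\<^sub>R axis i 1) =
      quad_half A z + t * (A *v z) $ i + t\<^sup>2 * quad_half A (axis i 1)" for t
  proof -
    have "z \<bullet> (A *v axis i 1) = axis i 1 \<bullet> (A *v z)"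
      by (metis assms dot_lmul_matrix inner_commute vector_transpose_matrix)
    then show ?thesis
      unfolding quad_half_def
      by (simp add: matrix_vector_right_distrib matrix_vector_mult_scaleR inner_add inner_axis'
          field_simps power2_eq_square)
  qed
  then show "((\<lambda>t. quad_half A (z + t *\<^sub>R axis i 1)) has_field_derivative (A *v z) $ i) (at 0)"
    by (auto intro!: derivative_eq_intros)
qed

lemma pdiff_on_prod_lin:
  assumes "\<And>i j. A $ i $ j = a i j" "\<And>i j. a i j = a j i"
  shows "pdiff_on U i (\<lambda>z. \<Prod>u\<leftarrow>us. (A *v z) $ u)
    (\<lambda>z. \<Sum>(b, vs)\<leftarrow>strike a i us. b * (\<Prod>u\<leftarrow>vs. (A *v z) $ u))"
proof (induction us)
  case Nil
  then show ?case using pdiff_on_const by simp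
next
  case (Cons u us)
  have "pdiff_on U i (\<lambda>z. (A *v z) $ u * (\<Prod>u\<leftarrow>us. (A *v z) $ u))
    (\<lambda>z. A $ u $ i * (\<Prod>u\<leftarrow>us. (A *v z) $ u) +
      (A *v z) $ u * (\<Sum>(b, vs)\<leftarrow>strike a i us. b * (\<Prod>u\<leftarrow>vs. (A *v z) $ u)))"
    using pdiff_on_lin Cons by (rule pdiff_on_mult)
  moreover have "A $ u $ i = a i u" using assms by metis
  ultimately show ?case
    by (simp add: o_def case_prod_unfold mult.left_commute flip: sum_list_const_mult)
qed

text \<open>An index left unmatched raises both sides by two; a matched one lengthens the index list
  by one and removes one unmatched index.\<close>

lemma matchings_order:
  "(c, us, m) \<in> set (matchings a is) \<Longrightarrow> 2 * m = length is + length us"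
proof (induction "is" arbitrary: c us m)
  case (Cons i "is")
  have strike: "length us = Suc (length vs)" if "(b, vs) \<in> set (strike a i us)" for b vs us
    using that by (induction us arbitrary: b vs) force+
  from Cons.prems Cons.IH show ?case
    by (fastforce dest: strike)
qed simp

text \<open>All derivatives of the outer function are supplied as one family, so that closed forms
  can be inserted for the exponential and for a power.\<close>

locale quadratic_composition =
  fixes A :: "real^'d::finite^'d" and \<Phi> :: "nat \<Rightarrow> real \<Rightarrow> real"
  assumes symm: "transpose A = A"
    and deriv: "\<And>m x. (\<Phi> m has_field_derivative \<Phi> (Suc m) x) (at x)"
begin

abbreviation "ent \<equiv> \<lambda>i j. A $ i $ j"

lemma ent_commute: "ent i j = ent j i"
  using symm by (metis transpose_def vec_lambda_beta)

lemma pdiff_on_Phi: "pdiff_on U i (\<lambda>z. \<Phi> m (quad_half A z)) (\<lambda>z. \<Phi> (Suc m) (quad_half A z) * (A *v z) $ i)"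
  using pdiff_on_quad_half[OF symm] by (rule pdiff_on_comp) (rule deriv)

text \<open>A new index either hits the outer function, which by the chain rule leaves a factor
  \<open>(A *v z) $ i\<close> and an unmatched index, or hits one of the linear factors, which pairs
  it with the index of that factor.\<close>

lemma partial_derivs_quadratic:
  "partial_derivs is (\<lambda>z. \<Phi> 0 (quad_half A z)) =
    (\<lambda>z. \<Sum>(c, us, m)\<leftarrow>matchings ent is. c * (\<Prod>u\<leftarrow>us. (A *v z) $ u) * \<Phi> m (quad_half A z))"
proof (induction "is")
  case (Cons i "is")
  let ?l = "\<lambda>us z. \<Prod>u\<leftarrow>us. (A *v z) $ u" and ?f = "\<lambda>m z. \<Phi> m (quad_half A z)"
  have "pdiff_on UNIV i (\<lambda>z. c * ?l us z * ?f m z)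
      (\<lambda>z. (c * ?l (i # us) z * ?f (Suc m) z) +
        (\<Sum>(b, vs)\<leftarrow>strike ent i us. (c * b) * ?l vs z * ?f m z))" for c us m
  proof -
    let ?s = "\<lambda>z. \<Sum>(b, vs)\<leftarrow>strike ent i us. b * ?l vs z"
    have "pdiff_on UNIV i (\<lambda>z. (c * ?l us z) * ?f m z)
      (\<lambda>z. (0 * ?l us z + c * ?s z) * ?f m z + (c * ?l us z) * (?f (Suc m) z * (A *v z) $ i))"
      by (intro pdiff_on_mult pdiff_on_Phi pdiff_on_const pdiff_on_prod_lin refl ent_commute)
    moreover have "(\<Sum>(b, vs)\<leftarrow>strike ent i us. (c * b) * ?l vs z * ?f m z) = c * ?s z * ?f m z" for z
      by (simp add: case_prod_unfold mult.assoc sum_list_const_mult flip: sum_list_mult_const)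
    ultimately show ?thesis
      by (simp add: algebra_simps)
  qed
  then have "pdiff_on UNIV i
      (\<lambda>z. \<Sum>x\<leftarrow>matchings ent is. case x of (c, us, m) \<Rightarrow> c * ?l us z * ?f m z)
      (\<lambda>z. \<Sum>x\<leftarrow>matchings ent is. case x of (c, us, m) \<Rightarrow> (c * ?l (i # us) z * ?f (Suc m) z) +
        (\<Sum>(b, vs)\<leftarrow>strike ent i us. (c * b) * ?l vs z * ?f m z))"
    by (intro pdiff_on_sum_list) (simp add: case_prod_unfold)
  then have "partial_deriv i (\<lambda>z. \<Sum>x\<leftarrow>matchings ent is. case x of (c, us, m) \<Rightarrow> c * ?l us z * ?f m z) =
      (\<lambda>z. \<Sum>x\<leftarrow>matchings ent is. case x of (c, us, m) \<Rightarrow> (c * ?l (i # us) z * ?f (Suc m) z) +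
        (\<Sum>(b, vs)\<leftarrow>strike ent i us. (c * b) * ?l vs z * ?f m z))"
    by (auto dest: pdiff_onD)
  also have "\<dots> = (\<lambda>z. \<Sum>(c, us, m)\<leftarrow>matchings ent (i # is). c * ?l us z * ?f m z)"
    
  proof -
    have "sum_list (map f (concat (map h xs))) = (\<Sum>x\<leftarrow>xs. sum_list (map f (h x)))"
      for f :: "real \<times> 'd list \<times> nat \<Rightarrow> real" and h and xs :: "(real \<times> 'd list \<times> nat) list"
      by (induction xs) auto
    then show ?thesis by (simp add: o_def case_prod_unfold)
  qed
  finally show ?case by (simp add: Cons.IH)
qed simp

lemma partial_derivs_quadratic_0:
  "partial_derivs is (\<lambda>z. \<Phi> 0 (quad_half A z)) 0 = pairings ent is * \<Phi> (length is div 2) 0"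
proof -
  have "(case x of (c, us, m) \<Rightarrow> c * (\<Prod>u\<leftarrow>us. (A *v 0) $ u) * \<Phi> m (quad_half A 0)) =
      (case x of (c, us, m) \<Rightarrow> if us = [] then c else 0) * \<Phi> (length is div 2) 0"
    if "x \<in> set (matchings ent is)" for x
  proof -
    obtain c us m where x: "x = (c, us, m)" by (cases x)
    \<comment> \<open>All perfect matchings thus carry the same derivative of the outer function,
      which factors out of the sum.\<close>
    then have "2 * m = length is + length us" using that matchings_order by metis
    then have "m = length is div 2" if "us = []" using that by simp
    then show ?thesis
      unfolding x by (cases us) (auto simp: quad_half_def)
  qed
  then show ?thesis
    unfolding partial_derivs_quadratic pairings_def
    by (simp add: flip: sum_list_mult_const cong: map_cong)
qed

lemma partial_derivs_quadratic_mset_cong: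
  assumes "mset is = mset js"
  shows "partial_derivs is (\<lambda>z. \<Phi> 0 (quad_half A z)) z = partial_derivs js (\<lambda>z. \<Phi> 0 (quad_half A z)) z"
proof -
  \<comment> \<open>Closed under differentiation: the linear forms have constant derivatives, and
    that of \<open>\<Phi> m\<close> composed with the form is \<open>\<Phi> (Suc m)\<close> composed
    with it, times a linear form.\<close>
  define S where "S = range (\<lambda>u z. (A *v z) $ u) \<union> range (\<lambda>m z. \<Phi> m (quad_half A z))"
  have closed: "\<exists>G. fun_alg S G \<and> pdiff_on UNIV i g G" if "g \<in> S" for g i
  proof -
    have "fun_alg S (\<lambda>z. \<Phi> (Suc m) (quad_half A z) * (A *v z) $ i)" for m
      by (intro fun_alg.mult fun_alg.gen) (auto simp: S_def)
    with that show ?thesis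
      unfolding S_def using pdiff_on_Phi pdiff_on_lin fun_alg.const by blast
  qed
  have comm: "commuting_partials UNIV i j g" if "g \<in> S" for g i j
    using that unfolding S_def
  proof
    assume "g \<in> range (\<lambda>u z. (A *v z) $ u)"
    then show ?thesis
      unfolding commuting_partials_def using pdiff_on_lin pdiff_on_const by blast
  next
    assume "g \<in> range (\<lambda>m z. \<Phi> m (quad_half A z))"
    then obtain m where g: "g = (\<lambda>z. \<Phi> m (quad_half A z))" by blast
    define H where "H i j z = \<Phi> (Suc (Suc m)) (quad_half A z) * (A *v z) $ j * (A *v z) $ i +
        \<Phi> (Suc m) (quad_half A z) * A $ i $ j" for i j z
    have H: "pdiff_on UNIV j (\<lambda>z. \<Phi> (Suc m) (quad_half A z) * (A *v z) $ i) (H i j)" for i j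
      unfolding H_def by (intro pdiff_on_mult pdiff_on_Phi pdiff_on_lin)
    have "H i j = H j i"
      unfolding H_def ent_commute[of i j] by (simp add: mult_ac)
    with H[where i = j and j = i] have "pdiff_on UNIV i (\<lambda>z. \<Phi> (Suc m) (quad_half A z) * (A *v z) $ j) (H i j)"
      by (simp only:)
    with pdiff_on_Phi pdiff_on_Phi H show ?thesis
      unfolding g by (rule commuting_partialsI)
  qed
  have "fun_alg S (\<lambda>z. \<Phi> 0 (quad_half A z))"
    by (rule fun_alg.gen) (auto simp: S_def)
  from partial_derivs_mset_cong[OF open_UNIV this closed comm assms] show ?thesis by simp
qed

end

section \<open>Hermite polynomials at the origin\<close>

lemma hermite_const_eq_pairings:
  fixes A :: "real^'d::finite^'d"
  assumes "transpose A = A" "\<And>i j. g i j = A $ i $ j" "length is = 2 * k"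
  shows "hermite_const g is = (-1) ^ k * pairings g is"
proof -
  \<comment> \<open>The successive derivatives of \<open>x ^ k\<close>; the one of order
    \<open>k\<close> is the constant \<open>fact k\<close>, which cancels the factorial in
    \<open>hermite_const\<close>.\<close>
  define \<Phi> where "\<Phi> = (\<lambda>m (x::real). if m \<le> k then fact k / fact (k - m) * x ^ (k - m) else 0)"
  interpret quadratic_composition A \<Phi>
  proof
    show "transpose A = A" by fact
    fix m x
    show "(\<Phi> m has_field_derivative \<Phi> (Suc m) x) (at x)"
    proof (cases "Suc m \<le> k")
      case True
      then obtain l where l: "k - m = Suc l" "k - Suc m = l" by (metis Suc_diff_Suc Suc_le_lessD)
      have "((\<lambda>x. fact k / fact (Suc l) * x ^ Suc l) has_field_derivative
          fact k / fact (Suc l) * (real (Suc l) * x ^ l)) (at x)"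
        using DERIV_cmult[OF DERIV_pow[of "Suc l"], of "fact k / fact (Suc l)" x UNIV]
        by (simp only: diff_Suc_Suc diff_zero)
      moreover have "fact k / fact (Suc l) * (real (Suc l) * x ^ l) = fact k / fact l * x ^ l"
        by (simp add: divide_simps del: of_nat_Suc)
      ultimately have "((\<lambda>x. fact k / fact (Suc l) * x ^ Suc l) has_field_derivative fact k / fact l * x ^ l) (at x)"
        by simp
      then show ?thesis using True by (simp add: \<Phi>_def l)
    next
      case False
      \<comment> \<open>At \<open>m = k\<close> the derivative of a constant is taken, and beyond it
        that of zero.\<close>
      then show ?thesis by (cases "m = k") (auto simp: \<Phi>_def)
    qed
  qed
  have "(\<Sum>a\<in>UNIV. \<Sum>b\<in>UNIV. g a b * z $ a * z $ b / 2) = quad_half A z" for z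
    by (simp add: quad_half_def inner_vec_def matrix_vector_mult_def assms(2) sum_distrib_left
        sum_divide_distrib algebra_simps)
  then have *: "hermite_const g is = (-1) ^ k / fact k * partial_derivs is (\<lambda>z. \<Phi> 0 (quad_half A z)) 0"
    by (simp add: hermite_const_def assms(3) \<Phi>_def)
  have "g = ent" using assms(2) by blast
  then show ?thesis
    unfolding * partial_derivs_quadratic_0 by (simp add: assms(3) \<Phi>_def)
qed

lemma hermite_0:
  fixes \<Sigma> :: "real^'d::finite^'d"
  assumes "transpose (matrix_inv \<Sigma>) = matrix_inv \<Sigma>" "det \<Sigma> \<noteq> 0" "\<And>i j. g i j = matrix_inv \<Sigma> $ i $ j"
  shows "odd (length is) \<Longrightarrow> hermite \<Sigma> (mset is) 0 = 0"
    and "even (length is) \<Longrightarrow> hermite \<Sigma> (mset is) 0 = hermite_const g is"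
proof -
  let ?A = "matrix_inv \<Sigma>"
  define K where "K = 1 / sqrt ((2 * pi) ^ CARD('d) * det \<Sigma>)"
  define \<Phi> where "\<Phi> = (\<lambda>m x. (-1) ^ m * exp (- x) * K)"
  \<comment> \<open>The real \<open>sqrt\<close> vanishes only at 0, so a nonzero determinant makes
    the Gaussian constant nonzero and it cancels in the quotient.\<close>
  have K: "K \<noteq> 0" using assms(2) by (simp add: K_def)
  interpret quadratic_composition ?A \<Phi>
    by unfold_locales (use assms(1) in \<open>auto simp: \<Phi>_def intro!: derivative_eq_intros\<close>)
  have normal: "normal_density_vec \<Sigma> = (\<lambda>z. \<Phi> 0 (quad_half ?A z))"
    by (simp add: normal_density_vec_def \<Phi>_def quad_half_def K_def fun_eq_iff)
  \<comment> \<open>The enumeration chosen inside \<open>multi_deriv\<close> may differ from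
    \<open>is\<close>, but it has the same multiset.\<close>
  have "mset (SOME js. mset js = mset is) = mset is"
    by (rule someI) (rule refl)
  then have "multi_deriv (mset is) (normal_density_vec \<Sigma>) 0 = partial_derivs is (normal_density_vec \<Sigma>) 0"
    unfolding multi_deriv_def normal by (rule partial_derivs_quadratic_mset_cong)
  then have *: "hermite \<Sigma> (mset is) 0 = (-1) ^ length is * pairings ent is * (-1) ^ (length is div 2)"
    using K by (simp add: hermite_def normal partial_derivs_quadratic_0) (simp add: \<Phi>_def quad_half_def)
  have g: "g = ent" using assms(3) by blast
  show "hermite \<Sigma> (mset is) 0 = hermite_const g is" if "even (length is)"
    using that assms(1) unfolding *
    by (subst hermite_const_eq_pairings[of ?A g "is" "length is div 2"]) (auto simp: g)
  have "pairings ent is = 0" if "odd (length is)"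
  proof -
    have "us \<noteq> []" if "(c, us, m) \<in> set (matchings ent is)" for c us m
    proof
      assume "us = []"
      then have "length is = 2 * m" using matchings_order[OF that] by simp
      with \<open>odd (length is)\<close> show False by simp
    qed
    then have *: "map (\<lambda>(c, us, m). if us = [] then c else 0) (matchings ent is) =
        map (\<lambda>_. 0) (matchings ent is)"
      by (intro map_cong) auto
    show ?thesis
      unfolding pairings_def * by simp
  qed
  then show "hermite \<Sigma> (mset is) 0 = 0" if "odd (length is)"
    using that by (simp add: *)
qed

lemma hermite_const_4:
  fixes A :: "real^'d::finite^'d"
  assumes "transpose A = A" "\<And>i j. g i j = A $ i $ j"
  shows "hermite_const g [a, b, c, d] = g a b * g c d + g a c * g b d + g a d * g b c"
  by (subst hermite_const_eq_pairings[OF assms, where k = 2]) (simp_all add: pairings_def algebra_simps)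

text \<open>The fifteen perfect matchings, grouped by the partner of \<open>a\<close>; the sign is
  (-1)^3.\<close>

lemma hermite_const_6:
  fixes A :: "real^'d::finite^'d"
  assumes "transpose A = A" "\<And>i j. g i j = A $ i $ j"
  shows "hermite_const g [a, b, c, d, e, f] = -
    (g a b * (g c d * g e f + g c e * g d f + g c f * g d e) +
     g a c * (g b d * g e f + g b e * g d f + g b f * g d e) +
     g a d * (g b c * g e f + g b e * g c f + g b f * g c e) +
     g a e * (g b c * g d f + g b d * g c f + g b f * g c d) +
     g a f * (g b c * g d e + g b d * g c e + g b e * g c d))"
  by (subst hermite_const_eq_pairings[OF assms, where k = 3]) (simp_all add: pairings_def algebra_simps)

section \<open>Differentiation under the integral sign\<close>

text \<open>Left unnormalised, so that differentiation in a coordinate direction simply multiplies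
  the integrand by that coordinate.\<close>

definition tilted :: "(real^'d) measure \<Rightarrow> (real^'d \<Rightarrow> real) \<Rightarrow> real^'d::finite \<Rightarrow> real" where
  "tilted \<mu> P \<theta> = (\<integral>x. P x * exp (x \<bullet> \<theta>) \<partial>\<mu>)"

definition tilt_integrable :: "(real^'d) measure \<Rightarrow> (real^'d) set \<Rightarrow> (real^'d::finite \<Rightarrow> real) \<Rightarrow> bool" where
  "tilt_integrable \<mu> \<Theta> P \<longleftrightarrow> P \<in> borel_measurable borel \<and>
     (\<forall>\<theta>\<in>\<Theta>. integrable \<mu> (\<lambda>x. P x * exp (x \<bullet> \<theta>)))"

lemma open_axis_shift:
  fixes \<Theta> :: "(real^'d::finite) set"
  assumes "open \<Theta>" "\<theta> \<in> \<Theta>"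
  obtains \<delta> where "\<delta> > 0" "\<And>t. \<bar>t\<bar> \<le> \<delta> \<Longrightarrow> \<theta> + t *\<^sub>R axis j 1 \<in> \<Theta>"
proof -
  obtain e where e: "e > 0" "cball \<theta> e \<subseteq> \<Theta>"
    using assms open_contains_cball by blast
  have "\<theta> + t *\<^sub>R axis j 1 \<in> \<Theta>" if "\<bar>t\<bar> \<le> e" for t
    using e(2) that by (intro subsetD[OF e(2)]) (simp add: dist_norm)
  with e(1) that show ?thesis by blast
qed

lemma inner_axis_shift:
  fixes x :: "real^'d::finite"
  shows "x \<bullet> (\<theta> + t *\<^sub>R axis j 1) = x \<bullet> \<theta> + t * x $ j"
  by (simp add: inner_add_right inner_axis)

text \<open>Absorbs a coordinate factor into exponential tilts shifted by \<open>\<delta>\<close> in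
  both directions; for small \<open>\<delta>\<close> these stay in the open parameter set.\<close>

lemma abs_le_exp_sum:
  fixes y \<delta> :: real
  assumes "\<delta> > 0"
  shows "\<bar>y\<bar> \<le> (exp (\<delta> * y) + exp (- \<delta> * y)) / \<delta>"
proof -
  have "\<delta> * y \<le> exp (\<delta> * y)" "- \<delta> * y \<le> exp (- \<delta> * y)"
    using exp_ge_add_one_self[of "\<delta> * y"] exp_ge_add_one_self[of "- \<delta> * y"] by linarith+
  then have "\<bar>\<delta> * y\<bar> \<le> exp (\<delta> * y) + exp (- \<delta> * y)"
    using exp_gt_zero[of "\<delta> * y"] exp_gt_zero[of "- \<delta> * y"] unfolding abs_le_iff by linarith
  with assms show ?thesis
    by (simp add: abs_mult field_simps)
qed

text \<open>The bound does not depend on \<open>h\<close>, as dominated convergence requires. It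
  rests on |exp u - 1| \<le> |u| exp |u| and on exp (\<delta> |y|) being one of the two
  summands.\<close>

lemma abs_exp_diff_quotient_le:
  fixes y \<delta> h :: real
  assumes "\<bar>h\<bar> \<le> \<delta>" "h \<noteq> 0"
  shows "\<bar>(exp (h * y) - 1) / h\<bar> \<le> \<bar>y\<bar> * (exp (\<delta> * y) + exp (- \<delta> * y))"
proof -
  have "\<bar>exp u - 1\<bar> \<le> \<bar>u\<bar> * exp \<bar>u\<bar>" for u :: real
  proof (cases "u \<ge> 0")
    case True
    \<comment> \<open>Multiplying 1 - u \<le> exp (- u) by exp u and rearranging gives exp u - 1
      \<le> u exp u.\<close>
    have "(1 - u) * exp u \<le> exp (- u) * exp u"
      using exp_ge_add_one_self[of "- u"] by (intro mult_right_mono) auto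
    also have "\<dots> = 1" by (simp add: exp_minus field_simps)
    finally show ?thesis using True by (simp add: algebra_simps)
  next
    case False
    have "exp u < 1" using False by simp
    then have "\<bar>exp u - 1\<bar> \<le> \<bar>u\<bar> * 1"
      using exp_ge_add_one_self[of u] False by linarith
    also have "\<dots> \<le> \<bar>u\<bar> * exp \<bar>u\<bar>" by (intro mult_left_mono) auto
    finally show ?thesis .
  qed
  from this[of "h * y"] have "\<bar>(exp (h * y) - 1) / h\<bar> \<le> \<bar>y\<bar> * exp \<bar>h * y\<bar>"
    using assms(2) by (simp add: abs_mult field_simps)
  also have "exp \<bar>h * y\<bar> \<le> exp (\<delta> * \<bar>y\<bar>)"
    using assms(1) by (simp add: abs_mult mult_right_mono)
  also have "\<dots> \<le> exp (\<delta> * y) + exp (- \<delta> * y)"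
    by (cases "y \<ge> 0") auto
  finally show ?thesis by (simp add: mult_left_mono)
qed

context
  fixes \<mu> :: "(real^'d::finite) measure" and \<Theta> :: "(real^'d) set"
  assumes sets: "sets \<mu> = sets borel" and open_\<Theta>: "open \<Theta>"
begin

text \<open>The integrand is dominated by the tilts at two shifted parameters. Iterating this makes
  all moments finite on the open set.\<close>

lemma tilt_integrable_coord:
  assumes P: "tilt_integrable \<mu> \<Theta> P"
  shows "tilt_integrable \<mu> \<Theta> (\<lambda>x. x $ j * P x)"
  unfolding tilt_integrable_def
proof (intro conjI ballI)
  have [measurable]: "P \<in> borel_measurable borel" using P by (simp add: tilt_integrable_def)
  show "(\<lambda>x. x $ j * P x) \<in> borel_measurable borel" by measurable
  fix \<theta> assume "\<theta> \<in> \<Theta>"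
  then obtain \<delta> where \<delta>: "\<delta> > 0" "\<And>t. \<bar>t\<bar> \<le> \<delta> \<Longrightarrow> \<theta> + t *\<^sub>R axis j 1 \<in> \<Theta>"
    using open_axis_shift[OF open_\<Theta>] by metis
  let ?E = "\<lambda>t x. P x * exp (x \<bullet> (\<theta> + t *\<^sub>R axis j 1))"
  have int: "integrable \<mu> (?E t)" if "\<bar>t\<bar> \<le> \<delta>" for t
    using P \<delta>(2)[OF that] unfolding tilt_integrable_def by blast
  show "integrable \<mu> (\<lambda>x. x $ j * P x * exp (x \<bullet> \<theta>))"
  proof (rule Bochner_Integration.integrable_bound)
    show "integrable \<mu> (\<lambda>x. (\<bar>?E \<delta> x\<bar> + \<bar>?E (- \<delta>) x\<bar>) / \<delta>)"
      using \<delta>(1) by (intro integrable_divide Bochner_Integration.integrable_add integrable_abs int) auto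
    show "(\<lambda>x. x $ j * P x * exp (x \<bullet> \<theta>)) \<in> borel_measurable \<mu>"
      unfolding measurable_cong_sets[OF sets refl] by measurable
    show "AE x in \<mu>. norm (x $ j * P x * exp (x \<bullet> \<theta>)) \<le> norm ((\<bar>?E \<delta> x\<bar> + \<bar>?E (- \<delta>) x\<bar>) / \<delta>)"
    proof (rule AE_I2)
      fix x :: "real^'d"
      have "\<bar>x $ j\<bar> * (\<bar>P x\<bar> * exp (x \<bullet> \<theta>)) \<le>
          (exp (\<delta> * x $ j) + exp (- \<delta> * x $ j)) / \<delta> * (\<bar>P x\<bar> * exp (x \<bullet> \<theta>))"
        by (intro mult_right_mono abs_le_exp_sum \<delta>) auto
      also have "\<dots> = (\<bar>?E \<delta> x\<bar> + \<bar>?E (- \<delta>) x\<bar>) / \<delta>"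
        unfolding inner_axis_shift exp_add abs_mult using \<delta>(1) by (simp add: field_simps)
      finally show "norm (x $ j * P x * exp (x \<bullet> \<theta>)) \<le> norm ((\<bar>?E \<delta> x\<bar> + \<bar>?E (- \<delta>) x\<bar>) / \<delta>)"
        using \<delta>(1) by (simp add: abs_mult mult.assoc)
    qed
  qed
qed

text \<open>Dominated convergence for the difference quotients; the majorant,
  \<open>x $ j * P x\<close> tilted at the two shifted parameters, is integrable by
  \<open>tilt_integrable_coord\<close>.\<close>

lemma pdiff_on_tilted:
  assumes P: "tilt_integrable \<mu> \<Theta> P"
  shows "pdiff_on \<Theta> j (tilted \<mu> P) (tilted \<mu> (\<lambda>x. x $ j * P x))"
  unfolding pdiff_on_def
proof
  fix \<theta> assume \<theta>: "\<theta> \<in> \<Theta>"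
  have [measurable]: "P \<in> borel_measurable borel" using P by (simp add: tilt_integrable_def)
  obtain \<delta> where \<delta>: "\<delta> > 0" "\<And>t. \<bar>t\<bar> \<le> \<delta> \<Longrightarrow> \<theta> + t *\<^sub>R axis j 1 \<in> \<Theta>"
    using \<theta> open_axis_shift[OF open_\<Theta>] by metis
  let ?E = "\<lambda>t x. P x * exp (x \<bullet> (\<theta> + t *\<^sub>R axis j 1))"
  let ?D = "\<lambda>t x. x $ j * P x * exp (x \<bullet> (\<theta> + t *\<^sub>R axis j 1))"
  let ?Q = "\<lambda>h x. (exp (h * x $ j) - 1) / h * (P x * exp (x \<bullet> \<theta>))"
  let ?w = "\<lambda>x. \<bar>?D \<delta> x\<bar> + \<bar>?D (- \<delta>) x\<bar>"
  have int: "integrable \<mu> (?E t)" "integrable \<mu> (?D t)" if "\<bar>t\<bar> \<le> \<delta>" for t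
    using P tilt_integrable_coord[OF P] \<delta>(2)[OF that] unfolding tilt_integrable_def by blast+
  have quot: "(tilted \<mu> P (\<theta> + h *\<^sub>R axis j 1) - tilted \<mu> P \<theta>) / h = (\<integral>x. ?Q h x \<partial>\<mu>)"
    if "\<bar>h\<bar> \<le> \<delta>" "h \<noteq> 0" for h
  proof -
    have "tilted \<mu> P (\<theta> + h *\<^sub>R axis j 1) - tilted \<mu> P (\<theta> + 0 *\<^sub>R axis j 1) =
        (\<integral>x. ?E h x - ?E 0 x \<partial>\<mu>)"
      unfolding tilted_def using that \<delta>(1)
      by (intro Bochner_Integration.integral_diff[symmetric] int) auto
    then have "(tilted \<mu> P (\<theta> + h *\<^sub>R axis j 1) - tilted \<mu> P \<theta>) / h = (\<integral>x. (?E h x - ?E 0 x) / h \<partial>\<mu>)"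
      by simp
    also have "(\<lambda>x. (?E h x - ?E 0 x) / h) = ?Q h"
      unfolding inner_axis_shift exp_add using that by (auto simp: field_simps)
    finally show ?thesis .
  qed
  have lim: "((\<lambda>h. (exp (h * y) - 1) / h) \<longlongrightarrow> y) (at 0)" for y :: real
  proof -
    have "((\<lambda>h. exp (h * y)) has_field_derivative y) (at 0)"
      by (auto intro!: derivative_eq_intros)
    then show ?thesis by (simp add: DERIV_def)
  qed
  have "((\<lambda>h. (tilted \<mu> P (\<theta> + h *\<^sub>R axis j 1) - tilted \<mu> P \<theta>) / h) \<longlongrightarrow>
      tilted \<mu> (\<lambda>x. x $ j * P x) \<theta>) (at 0)"
    unfolding tendsto_at_iff_sequentially
  proof (intro allI impI)
    fix X :: "nat \<Rightarrow> real"
    assume X: "\<forall>i. X i \<in> UNIV - {0}" "X \<longlonglongrightarrow> 0"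
    then have "eventually (\<lambda>i. \<bar>X i\<bar> < \<delta>) sequentially"
      using tendstoD[OF X(2) \<delta>(1)] by simp
    then obtain N where N: "\<And>i. i \<ge> N \<Longrightarrow> \<bar>X i\<bar> \<le> \<delta>"
      unfolding eventually_sequentially using less_imp_le by blast
    \<comment> \<open>Dominated convergence works with sequences; the shift by \<open>N\<close>
      ensures that every increment is at most \<open>\<delta>\<close> in absolute value, so that the
      majorant applies to all terms.\<close>
    have "(\<lambda>i. \<integral>x. ?Q (X (i + N)) x \<partial>\<mu>) \<longlonglongrightarrow> (\<integral>x. x $ j * P x * exp (x \<bullet> \<theta>) \<partial>\<mu>)"
    proof (rule integral_dominated_convergence[where w = ?w])
      show "integrable \<mu> ?w"
        using \<delta>(1) by (intro Bochner_Integration.integrable_add integrable_abs int) auto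
      show "(\<lambda>x. x $ j * P x * exp (x \<bullet> \<theta>)) \<in> borel_measurable \<mu>"
        unfolding measurable_cong_sets[OF sets refl] by measurable
      show "?Q (X (i + N)) \<in> borel_measurable \<mu>" for i
        unfolding measurable_cong_sets[OF sets refl] by measurable
      show "AE x in \<mu>. (\<lambda>i. ?Q (X (i + N)) x) \<longlonglongrightarrow> x $ j * P x * exp (x \<bullet> \<theta>)"
      proof (rule AE_I2)
        fix x :: "real^'d"
        have "(\<lambda>i. (exp (X i * x $ j) - 1) / X i) \<longlonglongrightarrow> x $ j"
          using lim[of "x $ j"] X unfolding tendsto_at_iff_sequentially by (auto simp: o_def)
        from tendsto_mult_right[OF LIMSEQ_ignore_initial_segment[OF this, of N], of "P x * exp (x \<bullet> \<theta>)"]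
        show "(\<lambda>i. ?Q (X (i + N)) x) \<longlonglongrightarrow> x $ j * P x * exp (x \<bullet> \<theta>)"
          by (simp add: mult.assoc)
      qed
      show "AE x in \<mu>. norm (?Q (X (i + N)) x) \<le> ?w x" for i
      proof (rule AE_I2)
        fix x :: "real^'d"
        have "\<bar>(exp (X (i + N) * x $ j) - 1) / X (i + N)\<bar> * (\<bar>P x\<bar> * exp (x \<bullet> \<theta>)) \<le>
            \<bar>x $ j\<bar> * (exp (\<delta> * x $ j) + exp (- \<delta> * x $ j)) * (\<bar>P x\<bar> * exp (x \<bullet> \<theta>))"
          using X(1) by (intro mult_right_mono abs_exp_diff_quotient_le N) auto
        also have "\<dots> = ?w x"
          unfolding inner_axis_shift exp_add abs_mult by (simp add: algebra_simps)
        finally show "norm (?Q (X (i + N)) x) \<le> ?w x"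
          by (simp add: abs_mult)
      qed
    qed
    then have "(\<lambda>i. (tilted \<mu> P (\<theta> + X (i + N) *\<^sub>R axis j 1) - tilted \<mu> P \<theta>) / X (i + N))
        \<longlonglongrightarrow> tilted \<mu> (\<lambda>x. x $ j * P x) \<theta>"
      using quot N X(1) by (simp add: tilted_def)
    then show "((\<lambda>h. (tilted \<mu> P (\<theta> + h *\<^sub>R axis j 1) - tilted \<mu> P \<theta>) / h) \<circ> X)
        \<longlonglongrightarrow> tilted \<mu> (\<lambda>x. x $ j * P x) \<theta>"
      unfolding o_def by (rule LIMSEQ_offset)
  qed
  then show "((\<lambda>t. tilted \<mu> P (\<theta> + t *\<^sub>R axis j 1)) has_field_derivative
      tilted \<mu> (\<lambda>x. x $ j * P x) \<theta>) (at 0)"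
    by (simp add: DERIV_def)
qed

end

section \<open>Minimal natural exponential families\<close>

definition moment :: "(real^'d) measure \<Rightarrow> 'd list \<Rightarrow> real^'d::finite \<Rightarrow> real" where
  "moment \<mu> is = tilted \<mu> (\<lambda>x. \<Prod>i\<leftarrow>is. x $ i)"

lemma moment_swap: "moment \<mu> (i # j # is) = moment \<mu> (j # i # is)"
  by (simp add: moment_def mult.left_commute)

text \<open>The transposed inverse is again a right inverse of \<open>S\<close>, and inverses are
  unique.\<close>

lemma matrix_inv_symmetric:
  fixes S :: "real^'n::finite^'n"
  assumes "transpose S = S" "invertible S"
  shows "transpose (matrix_inv S) = matrix_inv S"
proof -
  have inv: "S ** matrix_inv S = mat 1" "matrix_inv S ** S = mat 1"
    using someI_ex[OF assms(2)[unfolded invertible_def]] unfolding matrix_inv_def by blast+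
  have "S ** transpose (matrix_inv S) = mat 1"
    using arg_cong[OF inv(2), of transpose] by (simp add: matrix_transpose_mul assms(1) transpose_mat)
  then have "matrix_inv S ** (S ** transpose (matrix_inv S)) = matrix_inv S"
    by simp
  then show ?thesis by (simp add: matrix_mul_assoc inv(2))
qed

locale minimal_nef =
  fixes \<mu> :: "(real^'d::finite) measure" and \<Theta> :: "(real^'d) set"
  assumes nef: "natural_exponential_family \<mu> \<Theta>" and full: "full_order \<mu>"
begin

lemma sets_\<mu>: "sets \<mu> = sets borel" and open_\<Theta>: "open \<Theta>"
  using nef by (auto simp: natural_exponential_family_def)

abbreviation "dens \<theta> x \<equiv> exp (x \<bullet> \<theta> - log_partition \<mu> \<theta>)"

lemma measurable_\<mu>: "f \<in> borel_measurable borel \<Longrightarrow> f \<in> borel_measurable \<mu>"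
  using measurable_cong_sets[OF sets_\<mu> refl] by blast

lemma prob_space_member: "\<theta> \<in> \<Theta> \<Longrightarrow> prob_space (nef_member \<mu> \<theta>)"
  using nef by (auto simp: natural_exponential_family_def)

text \<open>Total mass one is where finiteness of the partition function on \<open>\<Theta>\<close>
  enters.\<close>

lemma dens_integral:
  assumes "\<theta> \<in> \<Theta>"
  shows "integrable \<mu> (dens \<theta>)" "(\<integral>x. dens \<theta> x \<partial>\<mu>) = 1"
proof -
  have meas: "dens \<theta> \<in> borel_measurable \<mu>"
    by (intro measurable_\<mu>) measurable
  have "emeasure (nef_member \<mu> \<theta>) (space (nef_member \<mu> \<theta>)) = 1"
    using prob_space_member[OF assms] by (rule prob_space.emeasure_space_1)
  then have nn: "(\<integral>\<^sup>+x. ennreal (dens \<theta> x) \<partial>\<mu>) = 1"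
    using meas unfolding nef_member_def by (simp add: emeasure_density nn_integral_set_ennreal cong: nn_integral_cong)
  then show int: "integrable \<mu> (dens \<theta>)"
    using meas by (intro integrableI_nonneg) auto
  show "(\<integral>x. dens \<theta> x \<partial>\<mu>) = 1"
    using nn nn_integral_eq_integral[OF int] by simp
qed

lemma exp_eq_dens: "exp (x \<bullet> \<theta>) = exp (log_partition \<mu> \<theta>) * dens \<theta> x"
  by (simp flip: exp_add)

lemma moment_Nil_eq: "moment \<mu> [] \<theta> = (\<integral>x. exp (x \<bullet> \<theta>) \<partial>\<mu>)"
  by (simp add: moment_def tilted_def)

text \<open>Derived from normalisation; cancelling \<open>exp\<close> against \<open>ln\<close>
  would presuppose the positivity that \<open>moment_Nil_pos\<close> deduces from it.\<close>

lemma moment_Nil: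
  assumes "\<theta> \<in> \<Theta>"
  shows "moment \<mu> [] \<theta> = exp (log_partition \<mu> \<theta>)"
  unfolding moment_Nil_eq exp_eq_dens using dens_integral[OF assms] by simp

lemma tilt_integrable_prod: "tilt_integrable \<mu> \<Theta> (\<lambda>x. \<Prod>i\<leftarrow>is. x $ i)"
proof (induction "is")
  case Nil
  show ?case
    unfolding tilt_integrable_def
  proof (intro conjI ballI)
    fix \<theta> assume "\<theta> \<in> \<Theta>"
    from integrable_mult_right[OF dens_integral(1)[OF this], of "exp (log_partition \<mu> \<theta>)"]
    show "integrable \<mu> (\<lambda>x. (\<Prod>i\<leftarrow>[]. x $ i) * exp (x \<bullet> \<theta>))"
      by (simp flip: exp_eq_dens)
  qed simp
next
  case (Cons i "is")
  from tilt_integrable_coord[OF sets_\<mu> open_\<Theta> this] show ?case by simp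
qed

lemma pdiff_on_moment: "pdiff_on \<Theta> j (moment \<mu> is) (moment \<mu> (j # is))"
  using pdiff_on_tilted[OF sets_\<mu> open_\<Theta> tilt_integrable_prod] by (simp add: moment_def)

lemma moment_Nil_pos: "\<theta> \<in> \<Theta> \<Longrightarrow> moment \<mu> [] \<theta> > 0"
  by (simp add: moment_Nil)

abbreviation "inv_norm \<theta> \<equiv> inverse (moment \<mu> [] \<theta>)"

lemma pdiff_on_log_partition:
  "pdiff_on \<Theta> j (log_partition \<mu>) (\<lambda>\<theta>. inv_norm \<theta> * moment \<mu> [j] \<theta>)"
proof -
  have "log_partition \<mu> = (\<lambda>\<theta>. ln (moment \<mu> [] \<theta>))"
    by (simp add: log_partition_def moment_Nil_eq fun_eq_iff)
  moreover have "pdiff_on \<Theta> j (\<lambda>\<theta>. ln (moment \<mu> [] \<theta>)) (\<lambda>\<theta>. inv_norm \<theta> * moment \<mu> [j] \<theta>)"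
    using pdiff_on_moment by (rule pdiff_on_comp) (rule DERIV_ln[OF moment_Nil_pos])
  ultimately show ?thesis by simp
qed

lemma pdiff_on_inv_norm:
  "pdiff_on \<Theta> j inv_norm (\<lambda>\<theta>. - (inv_norm \<theta> * inv_norm \<theta>) * moment \<mu> [j] \<theta>)"
proof -
  have "(inverse has_field_derivative - (inverse y * inverse y)) (at y)" if "y \<noteq> 0" for y :: real
    using DERIV_inverse[OF that] by simp
  with moment_Nil_pos show ?thesis
    by (intro pdiff_on_comp[OF pdiff_on_moment, where f = inverse and f' = "\<lambda>y. - (inverse y * inverse y)"])
       (metis less_irrefl)
qed

lemma pdiff_on_log_partition_2:
  "pdiff_on \<Theta> i (\<lambda>\<theta>. inv_norm \<theta> * moment \<mu> [j] \<theta>)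
    (\<lambda>\<theta>. - (inv_norm \<theta> * inv_norm \<theta>) * moment \<mu> [i] \<theta> * moment \<mu> [j] \<theta> + inv_norm \<theta> * moment \<mu> [i, j] \<theta>)"
  by (intro pdiff_on_mult pdiff_on_inv_norm pdiff_on_moment)

lemma cumulant_mset_cong:
  assumes "mset is = mset js" "\<theta> \<in> \<Theta>"
  shows "cumulant \<mu> \<theta> is = cumulant \<mu> \<theta> js"
proof -
  \<comment> \<open>An algebra has neither logarithms nor reciprocals, so both are generators.
    Differentiation turns the logarithm into \<open>inv_norm\<close> times a moment,
    \<open>inv_norm\<close> into minus its square times a moment, and a moment into a higher
    one.\<close>
  define S where "S = {log_partition \<mu>, inv_norm} \<union> range (moment \<mu>)"
  have moment: "fun_alg S (moment \<mu> is)" and inv: "fun_alg S inv_norm" for "is"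
    by (auto simp: S_def intro: fun_alg.gen)
  have inv': "fun_alg S (\<lambda>\<theta>. - (inv_norm \<theta> * inv_norm \<theta>) * moment \<mu> [i] \<theta>)" for i
  proof -
    have "fun_alg S (\<lambda>\<theta>. (-1) * (inv_norm \<theta> * inv_norm \<theta>) * moment \<mu> [i] \<theta>)"
      by (intro fun_alg.mult inv moment fun_alg.const)
    then show ?thesis by simp
  qed
  have closed: "\<exists>G. fun_alg S G \<and> pdiff_on \<Theta> i g G" if g: "g \<in> S" for g i
  proof -
    consider "g = log_partition \<mu>" | "g = inv_norm" | "is" where "g = moment \<mu> is"
      using g by (auto simp: S_def)
    then show ?thesis
    proof cases
      case 1
      then show ?thesis using pdiff_on_log_partition fun_alg.mult[OF inv moment] by blast
    next
      case 2
      then show ?thesis using pdiff_on_inv_norm inv' by blast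
    next
      case 3
      then show ?thesis using pdiff_on_moment moment by blast
    qed
  qed
  have comm: "commuting_partials \<Theta> i j g" if g: "g \<in> S" for g i j
  proof -
    consider "g = log_partition \<mu>" | "g = inv_norm" | "is" where "g = moment \<mu> is"
      using g by (auto simp: S_def)
    then show ?thesis
    proof cases
      case 1
      define H where "H i j \<theta> = - (inv_norm \<theta> * inv_norm \<theta>) * moment \<mu> [i] \<theta> * moment \<mu> [j] \<theta> +
        inv_norm \<theta> * moment \<mu> [i, j] \<theta>" for i j \<theta>
      have H: "pdiff_on \<Theta> i (\<lambda>\<theta>. inv_norm \<theta> * moment \<mu> [j] \<theta>) (H i j)" for i j
        using pdiff_on_log_partition_2 unfolding H_def .
      have "H i j = H j i"
        unfolding H_def moment_swap[of \<mu> i j] by (simp add: mult_ac)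
      with H[of j i] have "pdiff_on \<Theta> j (\<lambda>\<theta>. inv_norm \<theta> * moment \<mu> [i] \<theta>) (H i j)"
        by (simp only:)
      from commuting_partialsI[OF pdiff_on_log_partition pdiff_on_log_partition this H] show ?thesis
        unfolding 1 .
    next
      case 2
      \<comment> \<open>Left in the unsimplified shape that the product rule yields for a product
        with constant factor -1.\<close>
      define H where "H i j \<theta> = (0 * (inv_norm \<theta> * inv_norm \<theta>) + (-1) *
          (- (inv_norm \<theta> * inv_norm \<theta>) * moment \<mu> [i] \<theta> * inv_norm \<theta> +
           inv_norm \<theta> * (- (inv_norm \<theta> * inv_norm \<theta>) * moment \<mu> [i] \<theta>))) * moment \<mu> [j] \<theta> +
          (-1) * (inv_norm \<theta> * inv_norm \<theta>) * moment \<mu> [i, j] \<theta>" for i j \<theta>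
      have "pdiff_on \<Theta> i (\<lambda>\<theta>. (-1) * (inv_norm \<theta> * inv_norm \<theta>) * moment \<mu> [j] \<theta>) (H i j)" for i j
        unfolding H_def
        by (intro pdiff_on_mult pdiff_on_const pdiff_on_inv_norm pdiff_on_moment)
      then have H: "pdiff_on \<Theta> i (\<lambda>\<theta>. - (inv_norm \<theta> * inv_norm \<theta>) * moment \<mu> [j] \<theta>) (H i j)" for i j
        by simp
      have "H i j = H j i"
        unfolding H_def moment_swap[of \<mu> i j] by (simp add: mult_ac)
      with H[of j i] have "pdiff_on \<Theta> j (\<lambda>\<theta>. - (inv_norm \<theta> * inv_norm \<theta>) * moment \<mu> [i] \<theta>) (H i j)"
        by (simp only:)
      from commuting_partialsI[OF pdiff_on_inv_norm pdiff_on_inv_norm this H] show ?thesis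
        unfolding 2 .
    next
      case 3
      show ?thesis
        unfolding 3 using pdiff_on_moment[of i "is"] pdiff_on_moment[of j "is"] pdiff_on_moment[of j "i # is"]
          pdiff_on_moment[of i "j # is", folded moment_swap[of \<mu> j i]] by (rule commuting_partialsI)
    qed
  qed
  have "fun_alg S (log_partition \<mu>)" by (rule fun_alg.gen) (simp add: S_def)
  from partial_derivs_mset_cong[OF open_\<Theta> this closed comm assms] show ?thesis
    by (simp add: cumulant_def)
qed

section \<open>Mean and covariance of the members\<close>

lemma
  assumes "P \<in> borel_measurable borel"
  shows integrable_member_iff: "integrable (nef_member \<mu> \<theta>) P \<longleftrightarrow> integrable \<mu> (\<lambda>x. dens \<theta> x * P x)"
    and integral_member: "(\<integral>x. P x \<partial>nef_member \<mu> \<theta>) = (\<integral>x. dens \<theta> x * P x \<partial>\<mu>)"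
proof -
  have "dens \<theta> \<in> borel_measurable \<mu>" by (intro measurable_\<mu>) measurable
  with measurable_\<mu>[OF assms] show "integrable (nef_member \<mu> \<theta>) P \<longleftrightarrow> integrable \<mu> (\<lambda>x. dens \<theta> x * P x)"
      "(\<integral>x. P x \<partial>nef_member \<mu> \<theta>) = (\<integral>x. dens \<theta> x * P x \<partial>\<mu>)"
    unfolding nef_member_def by (simp_all add: integrable_density integral_density)
qed

lemma
  assumes "\<theta> \<in> \<Theta>"
  shows integrable_member_prod: "integrable (nef_member \<mu> \<theta>) (\<lambda>x. \<Prod>i\<leftarrow>is. x $ i)"
    and integral_member_prod: "(\<integral>x. (\<Prod>i\<leftarrow>is. x $ i) \<partial>nef_member \<mu> \<theta>) = inv_norm \<theta> * moment \<mu> is \<theta>"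
proof -
  have meas: "(\<lambda>x::real^'d. \<Prod>i\<leftarrow>is. x $ i) \<in> borel_measurable borel"
    using tilt_integrable_prod by (simp add: tilt_integrable_def)
  have eq: "dens \<theta> x * (\<Prod>i\<leftarrow>is. x $ i) = inv_norm \<theta> * ((\<Prod>i\<leftarrow>is. x $ i) * exp (x \<bullet> \<theta>))" for x
    by (simp add: moment_Nil[OF assms] exp_diff field_simps)
  show "integrable (nef_member \<mu> \<theta>) (\<lambda>x. \<Prod>i\<leftarrow>is. x $ i)"
    unfolding integrable_member_iff[OF meas] eq
    using tilt_integrable_prod assms by (intro integrable_mult_right) (auto simp: tilt_integrable_def)
  show "(\<integral>x. (\<Prod>i\<leftarrow>is. x $ i) \<partial>nef_member \<mu> \<theta>) = inv_norm \<theta> * moment \<mu> is \<theta>"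
    unfolding integral_member[OF meas] eq by (simp add: moment_def tilted_def)
qed

lemma integrable_member_id:
  assumes "\<theta> \<in> \<Theta>"
  shows "integrable (nef_member \<mu> \<theta>) (\<lambda>x. x)"
proof -
  have "integrable (nef_member \<mu> \<theta>) (\<lambda>x. \<Sum>i\<in>UNIV. x $ i *\<^sub>R (axis i 1 :: real^'d))"
    using integrable_member_prod[OF assms, of "[_]"]
    by (intro Bochner_Integration.integrable_sum integrable_scaleR_left) simp
  moreover have "(\<Sum>i\<in>UNIV. x $ i *\<^sub>R axis i 1) = x" for x :: "real^'d"
    using basis_expansion[of x] by (simp add: scalar_mult_eq_scaleR)
  ultimately show ?thesis by simp
qed

lemma mean_member_nth:
  assumes "\<theta> \<in> \<Theta>"
  shows "mean (nef_member \<mu> \<theta>) $ i = inv_norm \<theta> * moment \<mu> [i] \<theta>"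
  using integral_bounded_linear[OF bounded_linear_vec_nth integrable_member_id[OF assms], of i]
    integral_member_prod[OF assms, of "[i]"]
  by (simp add: mean_def)

lemma integrable_centered_product:
  assumes "\<theta> \<in> \<Theta>"
  shows "integrable (nef_member \<mu> \<theta>) (\<lambda>x. (x $ i - a) * (x $ j - b))"
    and "(\<integral>x. (x $ i - a) * (x $ j - b) \<partial>nef_member \<mu> \<theta>) =
      inv_norm \<theta> * moment \<mu> [i, j] \<theta> - b * (inv_norm \<theta> * moment \<mu> [i] \<theta>)
      - a * (inv_norm \<theta> * moment \<mu> [j] \<theta>) + a * b"
proof -
  interpret prob_space "nef_member \<mu> \<theta>" using prob_space_member[OF assms] .
  have int: "integrable (nef_member \<mu> \<theta>) (\<lambda>x. x $ i * x $ j)" "integrable (nef_member \<mu> \<theta>) (\<lambda>x. x $ k)" for k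
    using integrable_member_prod[OF assms, of "[i, j]"] integrable_member_prod[OF assms, of "[k]"] by simp_all
  have val: "(\<integral>x. x $ i * x $ j \<partial>nef_member \<mu> \<theta>) = inv_norm \<theta> * moment \<mu> [i, j] \<theta>"
     "(\<integral>x. x $ k \<partial>nef_member \<mu> \<theta>) = inv_norm \<theta> * moment \<mu> [k] \<theta>" for k
    using integral_member_prod[OF assms, of "[i, j]"] integral_member_prod[OF assms, of "[k]"] by simp_all
  have eq: "(\<lambda>x::real^'d. (x $ i - a) * (x $ j - b)) = (\<lambda>x. x $ i * x $ j - b * x $ i - a * x $ j + a * b)"
    by (auto simp: algebra_simps)
  show "integrable (nef_member \<mu> \<theta>) (\<lambda>x. (x $ i - a) * (x $ j - b))"
    unfolding eq by (intro Bochner_Integration.integrable_add Bochner_Integration.integrable_diff integrable_mult_right int) simp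
  show "(\<integral>x. (x $ i - a) * (x $ j - b) \<partial>nef_member \<mu> \<theta>) =
      inv_norm \<theta> * moment \<mu> [i, j] \<theta> - b * (inv_norm \<theta> * moment \<mu> [i] \<theta>)
      - a * (inv_norm \<theta> * moment \<mu> [j] \<theta>) + a * b"
    unfolding eq by (simp add: int val prob_space)
qed

text \<open>With Z the partition function and m the unnormalised moments, both entries equal m_ij /
  Z - m_i m_j / Z^2.\<close>

lemma covariance_eq_fisher:
  assumes "\<theta> \<in> \<Theta>"
  shows "covariance_matrix (nef_member \<mu> \<theta>) = fisher_metric \<mu> \<theta>"
proof -
  have *: "partial_derivs [i, j] (log_partition \<mu>) \<theta> =
      - (inv_norm \<theta> * inv_norm \<theta>) * moment \<mu> [i] \<theta> * moment \<mu> [j] \<theta> + inv_norm \<theta> * moment \<mu> [i, j] \<theta>" for i j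
  proof -
    have "partial_derivs [i, j] (log_partition \<mu>) \<theta> =
        partial_deriv i (\<lambda>\<theta>. inv_norm \<theta> * moment \<mu> [j] \<theta>) \<theta>"
      unfolding partial_derivs.simps using open_\<Theta> pdiff_onD[OF pdiff_on_log_partition] assms
      by (rule partial_deriv_cong)
    also have "\<dots> = - (inv_norm \<theta> * inv_norm \<theta>) * moment \<mu> [i] \<theta> * moment \<mu> [j] \<theta> + inv_norm \<theta> * moment \<mu> [i, j] \<theta>"
      using pdiff_on_log_partition_2 assms by (rule pdiff_onD)
    finally show ?thesis .
  qed
  show ?thesis
    unfolding covariance_matrix_def fisher_metric_def vec_eq_iff vec_lambda_beta *
      integrable_centered_product(2)[OF assms] mean_member_nth[OF assms]
    by (simp add: algebra_simps)
qed

text \<open>The form in which minimality is applied, once for injectivity of the mean map and once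
  for nondegeneracy of the covariance.\<close>

lemma hyperplane_trivial:
  assumes "AE x in \<mu>. w \<bullet> x = c"
  shows "w = 0"
proof (rule ccontr)
  assume "w \<noteq> 0"
  have "{x. w \<bullet> x = c} \<noteq> UNIV"
  proof
    assume "{x. w \<bullet> x = c} = UNIV"
    then have "w \<bullet> 0 = c" "w \<bullet> w = c" by blast+
    with \<open>w \<noteq> 0\<close> show False by simp
  qed
  then show False
    using full affine_hyperplane[of w c] assms unfolding full_order_def
    by (auto dest!: spec[of _ "{x. w \<bullet> x = c}"])
qed

text \<open>The density is strictly positive, so a member and \<open>\<mu>\<close> have the same
  null sets.\<close>

lemma AE_member_iff: "(AE x in nef_member \<mu> \<theta>. P x) \<longleftrightarrow> (AE x in \<mu>. P x)"
proof -
  have "(\<lambda>x. ennreal (dens \<theta> x)) \<in> borel_measurable \<mu>"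
    by (intro measurable_\<mu>) measurable
  then show ?thesis
    unfolding nef_member_def by (subst AE_density) auto
qed

text \<open>With \<open>p\<close> and \<open>q\<close> the densities of two members with the same mean, the integral of
  \<open>(ln p - ln q) * (p - q) \<ge> 0\<close> vanishes, so \<open>ln p - ln q\<close>, an affine function, is zero almost everywhere.\<close>

lemma nef_mean_inj: "inj_on (nef_mean \<mu>) \<Theta>"
proof (rule inj_onI)
  fix \<theta> \<eta> assume *: "\<theta> \<in> \<Theta>" "\<eta> \<in> \<Theta>" "nef_mean \<mu> \<theta> = nef_mean \<mu> \<eta>"
  define w where "w = \<theta> - \<eta>"
  define c where "c = log_partition \<mu> \<theta> - log_partition \<mu> \<eta>"
  have meas: "(\<lambda>x. x \<bullet> w - c) \<in> borel_measurable borel" by measurable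
  have int: "integrable \<mu> (\<lambda>x. dens t x * (x \<bullet> w - c))"
    and val: "(\<integral>x. dens t x * (x \<bullet> w - c) \<partial>\<mu>) = nef_mean \<mu> t \<bullet> w - c" if "t \<in> \<Theta>" for t
  proof -
    interpret prob_space "nef_member \<mu> t" using prob_space_member[OF that] .
    have "integrable (nef_member \<mu> t) (\<lambda>x. x \<bullet> w)"
      using integrable_member_id[OF that] by (rule integrable_inner_left)
    then have "integrable (nef_member \<mu> t) (\<lambda>x. x \<bullet> w - c)"
        "(\<integral>x. x \<bullet> w - c \<partial>nef_member \<mu> t) = nef_mean \<mu> t \<bullet> w - c"
      using integral_inner_left[OF integrable_member_id[OF that], of w]
      by (simp_all add: nef_mean_def mean_def prob_space)
    then show "integrable \<mu> (\<lambda>x. dens t x * (x \<bullet> w - c))"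
        "(\<integral>x. dens t x * (x \<bullet> w - c) \<partial>\<mu>) = nef_mean \<mu> t \<bullet> w - c"
      by (simp_all add: integrable_member_iff[OF meas] integral_member[OF meas])
  qed
  let ?f = "\<lambda>x. dens \<theta> x * (x \<bullet> w - c) - dens \<eta> x * (x \<bullet> w - c)"
  have f: "?f x = (exp u - exp v) * (u - v)"
    if "u = x \<bullet> \<theta> - log_partition \<mu> \<theta>" "v = x \<bullet> \<eta> - log_partition \<mu> \<eta>" for x u v
  proof -
    have "x \<bullet> w - c = u - v" by (simp add: that w_def c_def inner_diff_right)
    then show ?thesis unfolding that[symmetric] by (simp only: left_diff_distrib)
  qed
  have nonneg: "?f x \<ge> 0" for x
    unfolding f[OF refl refl] by (simp add: zero_le_mult_iff) linarith
  \<comment> \<open>Each of the two integrals is the common mean paired with \<open>w\<close>, minus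
    \<open>c\<close>, so they cancel.\<close>
  have "integrable \<mu> ?f" "(\<integral>x. ?f x \<partial>\<mu>) = 0"
    using int[OF *(1)] int[OF *(2)] val[OF *(1)] val[OF *(2)] *(3) by simp_all
  then have "AE x in \<mu>. ?f x = 0"
    using integral_nonneg_eq_0_iff_AE[of \<mu> ?f] nonneg by simp
  then have "AE x in \<mu>. w \<bullet> x = c"
  proof eventually_elim
    case (elim x)
    then have "x \<bullet> \<theta> - log_partition \<mu> \<theta> = x \<bullet> \<eta> - log_partition \<mu> \<eta>"
      unfolding f[OF refl refl] by simp
    then show ?case
      unfolding inner_commute[of w x] by (simp add: w_def c_def inner_diff_right)
  qed
  then have "w = 0" by (rule hyperplane_trivial)
  then show "\<theta> = \<eta>" by (simp add: w_def)
qed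

lemma nef_param_mean: "\<theta> \<in> \<Theta> \<Longrightarrow> nef_param \<mu> \<Theta> (nef_mean \<mu> \<theta>) = \<theta>"
  unfolding nef_param_def using nef_mean_inj by (auto dest: inj_onD)

lemma covariance_symmetric: "transpose (covariance_matrix Q) = covariance_matrix Q"
  by (simp add: transpose_def covariance_matrix_def vec_eq_iff mult.commute)

text \<open>A kernel vector \<open>v\<close> makes the variance of the linear functional
  \<open>v \<bullet> x\<close> vanish, so that functional is almost surely constant, and minimality
  forces \<open>v = 0\<close>.\<close>

lemma covariance_invertible:
  assumes "\<theta> \<in> \<Theta>"
  shows "invertible (covariance_matrix (nef_member \<mu> \<theta>))"
proof -
  let ?Q = "nef_member \<mu> \<theta>" let ?m = "mean ?Q"
  have "v = 0" if v: "covariance_matrix ?Q *v v = 0" for v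
  proof -
    have sq: "(\<Sum>i\<in>UNIV. \<Sum>j\<in>UNIV. v $ i * v $ j * ((x $ i - ?m $ i) * (x $ j - ?m $ j))) = (v \<bullet> x - v \<bullet> ?m)\<^sup>2" for x
      unfolding power2_eq_square
      by (simp add: inner_vec_def sum_product algebra_simps flip: sum_subtractf)
    have "0 = v \<bullet> (covariance_matrix ?Q *v v)" using v by simp
    also have "\<dots> = (\<Sum>i\<in>UNIV. \<Sum>j\<in>UNIV. v $ i * v $ j * (\<integral>x. (x $ i - ?m $ i) * (x $ j - ?m $ j) \<partial>?Q))"
      by (simp add: inner_vec_def matrix_vector_mult_def covariance_matrix_def sum_distrib_left mult_ac)
    also have "\<dots> = (\<integral>x. (v \<bullet> x - v \<bullet> ?m)\<^sup>2 \<partial>?Q)"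
      unfolding sq[symmetric] using integrable_centered_product[OF assms]
      by (simp add: Bochner_Integration.integral_sum)
    finally have int0: "(\<integral>x. (v \<bullet> x - v \<bullet> ?m)\<^sup>2 \<partial>?Q) = 0" by simp
    have "integrable ?Q (\<lambda>x. (v \<bullet> x - v \<bullet> ?m)\<^sup>2)"
      unfolding sq[symmetric] using integrable_centered_product[OF assms] by simp
    with int0 have "AE x in ?Q. (v \<bullet> x - v \<bullet> ?m)\<^sup>2 = 0"
      by (subst (asm) integral_nonneg_eq_0_iff_AE) auto
    then have "AE x in ?Q. v \<bullet> x = v \<bullet> ?m" by simp
    then have "AE x in \<mu>. v \<bullet> x = v \<bullet> ?m"
      by (subst (asm) AE_member_iff) auto
    then show "v = 0" by (rule hyperplane_trivial)
  qed
  then show ?thesis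
    by (simp add: invertible_left_inverse matrix_left_invertible_ker)
qed

end

section \<open>Edgeworth polynomials\<close>

text \<open>The linear functional that replaces each monomial by its weight; with Hermite values at
  0 as weights it turns \<open>edgeworth_poly\<close> into \<open>edgeworth_term\<close>.\<close>

definition poly_sum :: "('d multiset \<Rightarrow> real) \<Rightarrow> 'd polynomial \<Rightarrow> real" where
  "poly_sum w p = (\<Sum>\<alpha>\<in>Poly_Mapping.keys p. Poly_Mapping.lookup p \<alpha> * w \<alpha>)"

lemma poly_sum_superset:
  "finite A \<Longrightarrow> Poly_Mapping.keys p \<subseteq> A \<Longrightarrow>
    poly_sum w p = (\<Sum>\<alpha>\<in>A. Poly_Mapping.lookup p \<alpha> * w \<alpha>)"
  unfolding poly_sum_def by (rule sum.mono_neutral_left) (auto simp: in_keys_iff)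

lemma poly_sum_add: "poly_sum w (p + q) = poly_sum w p + poly_sum w q"
proof -
  let ?A = "Poly_Mapping.keys p \<union> Poly_Mapping.keys q"
  have "Poly_Mapping.keys (p + q) \<subseteq> ?A" by (rule Poly_Mapping.keys_add)
  then show ?thesis
    by (simp add: poly_sum_superset[of ?A] lookup_add ring_distribs sum.distrib)
qed

lemma poly_sum_single: "poly_sum w (Poly_Mapping.single \<alpha> c) = c * w \<alpha>"
  by (simp add: poly_sum_superset[of "{\<alpha>}"])

lemma poly_sum_sum: "poly_sum w (\<Sum>x\<in>A. p x) = (\<Sum>x\<in>A. poly_sum w (p x))"
proof -
  have "poly_sum w 0 = 0" by (simp add: poly_sum_def)
  then show ?thesis by (induction A rule: infinite_finite_induct) (auto simp: poly_sum_add)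
qed

lemma sum_lists_length_0: "(\<Sum>is | length is = 0. f is) = f []"
  by simp

lemma sum_lists_length_Suc:
  fixes f :: "'d::finite list \<Rightarrow> 'b::comm_monoid_add"
  shows "(\<Sum>is | length is = Suc r. f is) = (\<Sum>i\<in>UNIV. \<Sum>is | length is = r. f (i # is))"
proof -
  have "(\<Sum>is | length is = Suc r. f is) = (\<Sum>(i, is)\<in>UNIV \<times> {is. length is = r}. f (i # is))"
    by (rule sum.reindex_bij_witness[of _ "\<lambda>(i, is). i # is" "\<lambda>is. (hd is, tl is)"])
       (auto simp: length_Suc_conv)
  then show ?thesis by (simp add: sum.cartesian_product)
qed

lemma sum_UNIV_prod:
  "(\<Sum>p\<in>UNIV. case_prod f p) = (\<Sum>x\<in>UNIV. \<Sum>y\<in>UNIV. f x y)"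
  by (simp add: sum.cartesian_product)

text \<open>Coefficients are indexed by lists rather than multisets: sums over tuples of indices
  then appear directly, without multinomial counting, and products become concatenations.\<close>

definition tensor_poly :: "nat \<Rightarrow> ('d::finite list \<Rightarrow> real) \<Rightarrow> 'd polynomial" where
  "tensor_poly r c = (\<Sum>is | length is = r. Poly_Mapping.single (mset is) (c is))"

lemma poly_sum_tensor_poly: "poly_sum w (tensor_poly r c) = (\<Sum>is | length is = r. c is * w (mset is))"
  by (simp add: tensor_poly_def poly_sum_sum poly_sum_single)

lemma tensor_poly_mult:
  "tensor_poly r c * tensor_poly s d = tensor_poly (r + s) (\<lambda>is. c (take r is) * d (drop r is))"
proof -
  have "tensor_poly r c * tensor_poly s d =
      (\<Sum>(is, js)\<in>{is. length is = r} \<times> {js. length js = s}.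
        Poly_Mapping.single (mset (is @ js)) (c is * d js))"
    by (simp add: tensor_poly_def sum_product sum.cartesian_product mult_single)
  also have "\<dots> = tensor_poly (r + s) (\<lambda>is. c (take r is) * d (drop r is))"
    unfolding tensor_poly_def
    by (rule sum.reindex_bij_witness[of _ "\<lambda>is. (take r is, drop r is)" "\<lambda>(is, js). is @ js"]) auto
  finally show ?thesis .
qed

lemma single_mult_tensor_poly:
  "Poly_Mapping.single {#} k * tensor_poly r c = tensor_poly r (\<lambda>is. k * c is)"
  by (simp add: tensor_poly_def sum_distrib_left mult_single)

lemma tensor_poly_add: "tensor_poly r c + tensor_poly r d = tensor_poly r (\<lambda>is. c is + d is)"
  by (simp add: tensor_poly_def single_add sum.distrib)

lemma tensor_poly_add_left: "tensor_poly r c + (tensor_poly r d + p) = tensor_poly r (\<lambda>is. c is + d is) + p"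
  by (simp add: tensor_poly_add add.assoc[symmetric])

section \<open>Coefficients and degrees in the formal expansion\<close>

lemma cumulant_poly_tensor: "cumulant_poly \<kappa> r = tensor_poly r (\<lambda>is. 1 / fact r * \<kappa> is)"
  unfolding cumulant_poly_def tensor_poly_def[symmetric] by (rule single_mult_tensor_poly)

text \<open>Without a constant term, only compositions into positive parts contribute: 1+3, 3+1 and
  2+2 for the square, three orders of 1+1+2 for the cube. Multiplicities are repeated summands,
  later merged by \<open>tensor_poly_add\<close>.\<close>

lemma fps_power_low_coeffs:
  fixes e :: "'a::comm_ring_1 fps"
  assumes "fps_nth e 0 = 0"
  shows "fps_nth (e ^ 2) 2 = fps_nth e 1 * fps_nth e 1"
    and "fps_nth (e ^ 2) 4 = fps_nth e 1 * fps_nth e 3 + fps_nth e 1 * fps_nth e 3 + fps_nth e 2 * fps_nth e 2"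
    and "fps_nth (e ^ 3) 4 = fps_nth e 1 * fps_nth e 1 * fps_nth e 2 + fps_nth e 1 * fps_nth e 1 * fps_nth e 2
      + fps_nth e 1 * fps_nth e 1 * fps_nth e 2"
    and "fps_nth (e ^ 4) 4 = fps_nth e 1 * fps_nth e 1 * fps_nth e 1 * fps_nth e 1"
  by (simp_all add: numeral_eq_Suc fps_mult_nth assms algebra_simps)

lemma edgeworth_poly_unfold:
  "edgeworth_poly \<kappa> j = (\<Sum>i=0..j. Poly_Mapping.single {#} (1 / fact i) *
     fps_nth (edgeworth_exponent \<kappa> ^ i) j)"
  by (simp add: edgeworth_poly_def fps_compose_nth)

lemma edgeworth_exponent_nth:
  "fps_nth (edgeworth_exponent \<kappa>) 0 = 0"
  "m > 0 \<Longrightarrow> fps_nth (edgeworth_exponent \<kappa>) m = cumulant_poly \<kappa> (m + 2)"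
  by (simp_all add: edgeworth_exponent_def)

lemma edgeworth_poly_0: "edgeworth_poly \<kappa> 0 = Poly_Mapping.single {#} 1"
  by (simp add: edgeworth_poly_unfold single_one)

text \<open>1/24 is 1/4!, and 1/72 is half of 1/(3!)^2.\<close>

lemma edgeworth_poly_2:
  "edgeworth_poly \<kappa> 2 = tensor_poly 4 (\<lambda>is. 1/24 * \<kappa> is) +
     tensor_poly 6 (\<lambda>is. 1/72 * (\<kappa> (take 3 is) * \<kappa> (drop 3 is)))"
proof -
  let ?e = "edgeworth_exponent \<kappa>"
  note pow = fps_power_low_coeffs[of ?e, OF edgeworth_exponent_nth(1)]
  have "edgeworth_poly \<kappa> 2 = Poly_Mapping.single {#} 1 * fps_nth ?e 2 +
      Poly_Mapping.single {#} (1/2) * fps_nth (?e ^ 2) 2"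
    by (simp add: edgeworth_poly_unfold numeral_2_eq_2)
  then show ?thesis
    by (simp add: pow edgeworth_exponent_nth cumulant_poly_tensor tensor_poly_mult single_mult_tensor_poly
        fact_numeral del: One_nat_def)
qed

text \<open>In order the constants are 1/6!, (1/2) 2 / (3! 5!), (1/2) / (4!)^2, (1/6) 3 / (3! 3! 4!)
  and (1/24) / (3!)^4; the first two agree because 3! 5! = 6!.\<close>

lemma edgeworth_poly_4:
  "edgeworth_poly \<kappa> 4 = tensor_poly 6 (\<lambda>is. 1/720 * \<kappa> is) +
     tensor_poly 8 (\<lambda>is. 1/720 * (\<kappa> (take 3 is) * \<kappa> (drop 3 is))) +
     tensor_poly 8 (\<lambda>is. 1/1152 * (\<kappa> (take 4 is) * \<kappa> (drop 4 is))) +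
     tensor_poly 10 (\<lambda>is. 1/1728 * (\<kappa> (take 3 is) * \<kappa> (take 3 (drop 3 is)) * \<kappa> (drop 6 is))) +
     tensor_poly 12 (\<lambda>is. 1/31104 * (\<kappa> (take 3 is) * \<kappa> (take 3 (drop 3 is)) *
       \<kappa> (take 3 (drop 6 is)) * \<kappa> (drop 9 is)))"
proof -
  let ?e = "edgeworth_exponent \<kappa>"
  note pow = fps_power_low_coeffs[of ?e, OF edgeworth_exponent_nth(1)]
  have "edgeworth_poly \<kappa> 4 = Poly_Mapping.single {#} 1 * fps_nth ?e 4 +
      Poly_Mapping.single {#} (1/2) * fps_nth (?e ^ 2) 4 +
      Poly_Mapping.single {#} (1/6) * fps_nth (?e ^ 3) 4 +
      Poly_Mapping.single {#} (1/24) * fps_nth (?e ^ 4) 4"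
    by (simp add: edgeworth_poly_unfold eval_nat_numeral)
  then show ?thesis
    by (simp add: pow edgeworth_exponent_nth cumulant_poly_tensor tensor_poly_mult single_mult_tensor_poly
        fact_numeral distrib_left tensor_poly_add tensor_poly_add_left add.assoc take_drop mult.assoc
        del: One_nat_def)
      (simp add: mult_ac)
qed

text \<open>The coefficient of order k in the exponent is homogeneous of degree k + 2, so a product
  of \<open>i\<close> of them exceeds its order by \<open>2 * i\<close>.\<close>

lemma edgeworth_power_degree:
  "\<alpha> \<in> Poly_Mapping.keys (fps_nth (edgeworth_exponent \<kappa> ^ i) j) \<Longrightarrow> size \<alpha> = j + 2 * i"
proof (induction i arbitrary: j \<alpha>)
  case 0
  then show ?case by (auto split: if_splits)
next
  case (Suc i)
  from Suc.prems obtain k where k: "k \<le> j"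
    "\<alpha> \<in> Poly_Mapping.keys (fps_nth (edgeworth_exponent \<kappa>) k * fps_nth (edgeworth_exponent \<kappa> ^ i) (j - k))"
    unfolding power_Suc fps_mult_nth using keys_sum by fastforce
  with keys_mult obtain \<beta> \<gamma> where \<alpha>: "\<alpha> = \<beta> + \<gamma>"
    "\<beta> \<in> Poly_Mapping.keys (fps_nth (edgeworth_exponent \<kappa>) k)"
    "\<gamma> \<in> Poly_Mapping.keys (fps_nth (edgeworth_exponent \<kappa> ^ i) (j - k))"
    by fastforce
  have "size \<beta> = k + 2"
  proof (cases "k = 0")
    case False
    with \<alpha>(2) have "\<beta> \<in> Poly_Mapping.keys (tensor_poly (k + 2) (\<lambda>is. 1 / fact (k + 2) * \<kappa> is))"
      by (simp add: edgeworth_exponent_nth cumulant_poly_tensor)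
    then obtain "is" where "length is = k + 2"
        "\<beta> \<in> Poly_Mapping.keys (Poly_Mapping.single (mset is) (1 / fact (k + 2) * \<kappa> is))"
      unfolding tensor_poly_def using keys_sum by fastforce
    then show ?thesis by (auto split: if_splits)
  qed (use \<alpha>(2) in \<open>simp add: edgeworth_exponent_nth\<close>)
  with Suc.IH[OF \<alpha>(3)] k(1) \<alpha>(1) show ?case by simp
qed

lemma edgeworth_poly_parity:
  assumes "\<alpha> \<in> Poly_Mapping.keys (edgeworth_poly \<kappa> j)"
  shows "even (size \<alpha>) \<longleftrightarrow> even j"
proof -
  from assms obtain i where
    "\<alpha> \<in> Poly_Mapping.keys (Poly_Mapping.single {#} (1 / fact i) * fps_nth (edgeworth_exponent \<kappa> ^ i) j)"
    unfolding edgeworth_poly_unfold using keys_sum by fastforce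
  with keys_mult obtain \<beta> \<gamma> where "\<alpha> = \<beta> + \<gamma>"
    "\<beta> \<in> Poly_Mapping.keys (Poly_Mapping.single {#} (1 / fact i :: real))"
    "\<gamma> \<in> Poly_Mapping.keys (fps_nth (edgeworth_exponent \<kappa> ^ i) j)"
    by fastforce
  then show ?thesis
    by (auto dest: edgeworth_power_degree split: if_splits)
qed

section \<open>Merging pairings by relabelling summation indices\<close>

lemma sum_contractions_4:
  fixes k :: "'d::finite \<Rightarrow> 'd \<Rightarrow> 'd \<Rightarrow> 'd \<Rightarrow> real"
  assumes k: "\<And>a b c d. k a b c d = k b a c d" "\<And>a b c d. k a b c d = k a c b d"
      "\<And>a b c d. k a b c d = k a b d c"
    and g: "\<And>a b. g a b = g b a"
  shows "(\<Sum>(a, b, c, d)\<in>UNIV. k a b c d * (g a b * g c d + g a c * g b d + g a d * g b c)) =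
    3 * (\<Sum>(a, b, c, d)\<in>UNIV. k a b c d * g a b * g c d)"
proof -
  have "(\<Sum>(a, b, c, d)\<in>UNIV. k a b c d * (g a c * g b d)) = (\<Sum>(a, b, c, d)\<in>UNIV. k a b c d * g a b * g c d)"
    by (rule sum.reindex_bij_witness[of _ "\<lambda>(a, b, c, d). (a, c, b, d)" "\<lambda>(a, b, c, d). (a, c, b, d)"])
       (auto simp: k g)
  moreover
  have "(\<Sum>(a, b, c, d)\<in>UNIV. k a b c d * (g a d * g b c)) = (\<Sum>(a, b, c, d)\<in>UNIV. k a b c d * g a b * g c d)"
    by (rule sum.reindex_bij_witness[of _ "\<lambda>(a, b, c, d). (a, c, d, b)" "\<lambda>(a, b, c, d). (a, d, b, c)"])
       (auto simp: k g)
  ultimately show ?thesis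
    by (simp add: case_prod_unfold distrib_left sum.distrib mult.assoc)
qed

text \<open>Nine pairings join two indices inside each triple and leave one bridge between the
  triples; the other six are bijections between the triples. Relabelling identifies all pairings of
  the same kind.\<close>

lemma sum_contractions_6:
  fixes k :: "'d::finite \<Rightarrow> 'd \<Rightarrow> 'd \<Rightarrow> real"
  assumes k: "\<And>a b c. k a b c = k b a c" "\<And>a b c. k a b c = k a c b"
    and g: "\<And>a b. g a b = g b a"
  shows "(\<Sum>(a, b, c, d, e, f)\<in>UNIV. k a b c * k d e f *
    (g a b * (g c d * g e f + g c e * g d f + g c f * g d e) +
     g a c * (g b d * g e f + g b e * g d f + g b f * g d e) +
     g a d * (g b c * g e f + g b e * g c f + g b f * g c e) +
     g a e * (g b c * g d f + g b d * g c f + g b f * g c d) +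
     g a f * (g b c * g d e + g b d * g c e + g b e * g c d))) =
    9 * (\<Sum>(a, b, c, d, e, f)\<in>UNIV. k a b c * k d e f * g a b * g c d * g e f) +
    6 * (\<Sum>(a, b, c, d, e, f)\<in>UNIV. k a b c * k d e f * g a d * g b e * g c f)"
proof -
  have "(\<Sum>(a, b, c, d, e, f)\<in>UNIV. k a b c * k d e f * (g a b * (g c e * g d f))) =
      (\<Sum>(a, b, c, d, e, f)\<in>UNIV. k a b c * k d e f * g a b * g c d * g e f)"
    by (rule sum.reindex_bij_witness[of _ "\<lambda>(a, b, c, d, e, f). (a, b, c, e, d, f)" "\<lambda>(a, b, c, d, e, f). (a, b, c, e, d, f)"])
       (auto simp: k g)
  moreover
  have "(\<Sum>(a, b, c, d, e, f)\<in>UNIV. k a b c * k d e f * (g a b * (g c f * g d e))) =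
      (\<Sum>(a, b, c, d, e, f)\<in>UNIV. k a b c * k d e f * g a b * g c d * g e f)"
    by (rule sum.reindex_bij_witness[of _ "\<lambda>(a, b, c, d, e, f). (a, b, c, e, f, d)" "\<lambda>(a, b, c, d, e, f). (a, b, c, f, d, e)"])
       (auto simp: k g)
  moreover
  have "(\<Sum>(a, b, c, d, e, f)\<in>UNIV. k a b c * k d e f * (g a c * (g b d * g e f))) =
      (\<Sum>(a, b, c, d, e, f)\<in>UNIV. k a b c * k d e f * g a b * g c d * g e f)"
    by (rule sum.reindex_bij_witness[of _ "\<lambda>(a, b, c, d, e, f). (a, c, b, d, e, f)" "\<lambda>(a, b, c, d, e, f). (a, c, b, d, e, f)"])
       (auto simp: k g)
  moreover
  have "(\<Sum>(a, b, c, d, e, f)\<in>UNIV. k a b c * k d e f * (g a c * (g b e * g d f))) =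
      (\<Sum>(a, b, c, d, e, f)\<in>UNIV. k a b c * k d e f * g a b * g c d * g e f)"
    by (rule sum.reindex_bij_witness[of _ "\<lambda>(a, b, c, d, e, f). (a, c, b, e, d, f)" "\<lambda>(a, b, c, d, e, f). (a, c, b, e, d, f)"])
       (auto simp: k g)
  moreover
  have "(\<Sum>(a, b, c, d, e, f)\<in>UNIV. k a b c * k d e f * (g a c * (g b f * g d e))) =
      (\<Sum>(a, b, c, d, e, f)\<in>UNIV. k a b c * k d e f * g a b * g c d * g e f)"
    by (rule sum.reindex_bij_witness[of _ "\<lambda>(a, b, c, d, e, f). (a, c, b, e, f, d)" "\<lambda>(a, b, c, d, e, f). (a, c, b, f, d, e)"])
       (auto simp: k g)
  moreover
  have "(\<Sum>(a, b, c, d, e, f)\<in>UNIV. k a b c * k d e f * (g a d * (g b c * g e f))) =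
      (\<Sum>(a, b, c, d, e, f)\<in>UNIV. k a b c * k d e f * g a b * g c d * g e f)"
    by (rule sum.reindex_bij_witness[of _ "\<lambda>(a, b, c, d, e, f). (c, a, b, d, e, f)" "\<lambda>(a, b, c, d, e, f). (b, c, a, d, e, f)"])
       (auto simp: k g)
  moreover
  have "(\<Sum>(a, b, c, d, e, f)\<in>UNIV. k a b c * k d e f * (g a d * (g b f * g c e))) =
      (\<Sum>(a, b, c, d, e, f)\<in>UNIV. k a b c * k d e f * g a d * g b e * g c f)"
    by (rule sum.reindex_bij_witness[of _ "\<lambda>(a, b, c, d, e, f). (a, b, c, d, f, e)" "\<lambda>(a, b, c, d, e, f). (a, b, c, d, f, e)"])
       (auto simp: k g)
  moreover
  have "(\<Sum>(a, b, c, d, e, f)\<in>UNIV. k a b c * k d e f * (g a e * (g b c * g d f))) =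
      (\<Sum>(a, b, c, d, e, f)\<in>UNIV. k a b c * k d e f * g a b * g c d * g e f)"
    by (rule sum.reindex_bij_witness[of _ "\<lambda>(a, b, c, d, e, f). (c, a, b, e, d, f)" "\<lambda>(a, b, c, d, e, f). (b, c, a, e, d, f)"])
       (auto simp: k g)
  moreover
  have "(\<Sum>(a, b, c, d, e, f)\<in>UNIV. k a b c * k d e f * (g a e * (g b d * g c f))) =
      (\<Sum>(a, b, c, d, e, f)\<in>UNIV. k a b c * k d e f * g a d * g b e * g c f)"
    by (rule sum.reindex_bij_witness[of _ "\<lambda>(a, b, c, d, e, f). (a, b, c, e, d, f)" "\<lambda>(a, b, c, d, e, f). (a, b, c, e, d, f)"])
       (auto simp: k g)
  moreover
  have "(\<Sum>(a, b, c, d, e, f)\<in>UNIV. k a b c * k d e f * (g a e * (g b f * g c d))) =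
      (\<Sum>(a, b, c, d, e, f)\<in>UNIV. k a b c * k d e f * g a d * g b e * g c f)"
    by (rule sum.reindex_bij_witness[of _ "\<lambda>(a, b, c, d, e, f). (a, b, c, f, d, e)" "\<lambda>(a, b, c, d, e, f). (a, b, c, e, f, d)"])
       (auto simp: k g)
  moreover
  have "(\<Sum>(a, b, c, d, e, f)\<in>UNIV. k a b c * k d e f * (g a f * (g b c * g d e))) =
      (\<Sum>(a, b, c, d, e, f)\<in>UNIV. k a b c * k d e f * g a b * g c d * g e f)"
    by (rule sum.reindex_bij_witness[of _ "\<lambda>(a, b, c, d, e, f). (c, a, b, e, f, d)" "\<lambda>(a, b, c, d, e, f). (b, c, a, f, d, e)"])
       (auto simp: k g)
  moreover
  have "(\<Sum>(a, b, c, d, e, f)\<in>UNIV. k a b c * k d e f * (g a f * (g b d * g c e))) =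
      (\<Sum>(a, b, c, d, e, f)\<in>UNIV. k a b c * k d e f * g a d * g b e * g c f)"
    by (rule sum.reindex_bij_witness[of _ "\<lambda>(a, b, c, d, e, f). (a, b, c, e, f, d)" "\<lambda>(a, b, c, d, e, f). (a, b, c, f, d, e)"])
       (auto simp: k g)
  moreover
  have "(\<Sum>(a, b, c, d, e, f)\<in>UNIV. k a b c * k d e f * (g a f * (g b e * g c d))) =
      (\<Sum>(a, b, c, d, e, f)\<in>UNIV. k a b c * k d e f * g a d * g b e * g c f)"
    by (rule sum.reindex_bij_witness[of _ "\<lambda>(a, b, c, d, e, f). (a, b, c, f, e, d)" "\<lambda>(a, b, c, d, e, f). (a, b, c, f, e, d)"])
       (auto simp: k g)
  ultimately show ?thesis
    by (simp add: case_prod_unfold distrib_left sum.distrib mult.assoc)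
qed

section \<open>The Edgeworth function at the mean\<close>

lemma sum_lists_length_4: "(\<Sum>is | length is = 4. f is) = (\<Sum>(a, b, c, d)\<in>UNIV. f [a, b, c, d])"
  for f :: "'d::finite list \<Rightarrow> real"
  by (simp only: eval_nat_numeral BitM.simps One_nat_def sum_lists_length_Suc sum_lists_length_0 sum_UNIV_prod)

lemma sum_lists_length_6:
  "(\<Sum>is | length is = 6. f is) = (\<Sum>(a, b, c, d, e, i)\<in>UNIV. f [a, b, c, d, e, i])"
  for f :: "'d::finite list \<Rightarrow> real"
  by (simp only: eval_nat_numeral BitM.simps One_nat_def sum_lists_length_Suc sum_lists_length_0 sum_UNIV_prod)

lemma sum_lists_length_8:
  "(\<Sum>is | length is = 8. f is) =
    (\<Sum>(i1, i2, i3, i4, i5, i6, i7, i8)\<in>UNIV. f [i1, i2, i3, i4, i5, i6, i7, i8])"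
  for f :: "'d::finite list \<Rightarrow> real"
  by (simp only: eval_nat_numeral BitM.simps One_nat_def sum_lists_length_Suc sum_lists_length_0 sum_UNIV_prod)

lemma sum_lists_length_10:
  "(\<Sum>is | length is = 10. f is) =
    (\<Sum>(i1, i2, i3, i4, i5, i6, i7, i8, i9, i10)\<in>UNIV. f [i1, i2, i3, i4, i5, i6, i7, i8, i9, i10])"
  for f :: "'d::finite list \<Rightarrow> real"
  by (simp only: eval_nat_numeral BitM.simps One_nat_def sum_lists_length_Suc sum_lists_length_0 sum_UNIV_prod)

lemma sum_lists_length_12:
  "(\<Sum>is | length is = 12. f is) =
    (\<Sum>(i1, i2, i3, i4, i5, i6, i7, i8, i9, i10, i11, i12)\<in>UNIV.
      f [i1, i2, i3, i4, i5, i6, i7, i8, i9, i10, i11, i12])"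
  for f :: "'d::finite list \<Rightarrow> real"
  by (simp only: eval_nat_numeral BitM.simps One_nat_def sum_lists_length_Suc sum_lists_length_0 sum_UNIV_prod)

lemma poly_sum_scaled_tensor_poly:
  assumes "\<And>is. length is = r \<Longrightarrow> w (mset is) = h is"
  shows "poly_sum w (tensor_poly r (\<lambda>is. k * c is)) = k * (\<Sum>is | length is = r. c is * h is)"
  using assms by (simp add: poly_sum_tensor_poly sum_distrib_left mult.assoc)

lemma edgeworth_term_0: "edgeworth_term \<kappa> \<Sigma> j 0 = poly_sum (\<lambda>\<alpha>. hermite \<Sigma> \<alpha> 0) (edgeworth_poly \<kappa> j)"
  by (simp add: edgeworth_term_def poly_sum_def)

text \<open>Isolates the linear algebra and the symmetry of the cumulants from the measure they come
  from.\<close>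

locale edgeworth_at_mean =
  fixes \<kappa> :: "'d::finite list \<Rightarrow> real" and \<Sigma> :: "real^'d^'d" and g :: "'d \<Rightarrow> 'd \<Rightarrow> real"
  assumes inv_symm: "transpose (matrix_inv \<Sigma>) = matrix_inv \<Sigma>" and det: "det \<Sigma> \<noteq> 0"
    and g: "\<And>i j. g i j = matrix_inv \<Sigma> $ i $ j"
    and \<kappa>: "\<And>is js. mset is = mset js \<Longrightarrow> \<kappa> is = \<kappa> js"
begin

lemma hermite_even: "even (length is) \<Longrightarrow> hermite \<Sigma> (mset is) 0 = hermite_const g is"
  using hermite_0(2)[OF inv_symm det g] .

lemma edgeworth_term_odd:
  assumes "odd j"
  shows "edgeworth_term \<kappa> \<Sigma> j 0 = 0"
  unfolding edgeworth_term_def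
proof (rule sum.neutral, rule ballI)
  fix \<alpha> assume \<alpha>: "\<alpha> \<in> Poly_Mapping.keys (edgeworth_poly \<kappa> j)"
  obtain "is" where "is": "mset is = \<alpha>" using ex_mset by blast
  with edgeworth_poly_parity[OF \<alpha>] assms have "odd (length is)" by (metis size_mset)
  from hermite_0(1)[OF inv_symm det g this] "is"
  show "Poly_Mapping.lookup (edgeworth_poly \<kappa> j) \<alpha> * hermite \<Sigma> \<alpha> 0 = 0" by simp
qed

text \<open>Raising \<open>s\<close> by one adds an odd term, which vanishes, and an even term,
  whose exponent loses the factor 1/2.\<close>

lemma sum_edgeworth_terms:
  assumes "n \<ge> 1"
  shows "(\<Sum>j = 0..2 * s. real n powr (- (real j / 2)) * edgeworth_term \<kappa> \<Sigma> j 0) =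
    (\<Sum>i = 0..s. edgeworth_term \<kappa> \<Sigma> (2 * i) 0 * real n powr (- real i))"
proof (induction s)
  case (Suc s)
  have two: "2 * Suc s = Suc (Suc (2 * s))" by simp
  have "(\<Sum>j = 0..2 * Suc s. real n powr (- (real j / 2)) * edgeworth_term \<kappa> \<Sigma> j 0) =
      (\<Sum>j = 0..2 * s. real n powr (- (real j / 2)) * edgeworth_term \<kappa> \<Sigma> j 0) +
      real n powr (- (real (2 * Suc s) / 2)) * edgeworth_term \<kappa> \<Sigma> (2 * Suc s) 0"
    unfolding two sum.atLeast0_atMost_Suc by (simp add: edgeworth_term_odd)
  also have "- (real (2 * Suc s) / 2) = - real (Suc s)" by (simp add: field_simps)
  finally show ?case
    unfolding Suc sum.atLeast0_atMost_Suc by (simp only: mult.commute)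
qed simp

lemma edgeworth_term_Zero: "edgeworth_term \<kappa> \<Sigma> 0 0 = 1"
  using hermite_even[of "[]"]
  unfolding edgeworth_term_0 edgeworth_poly_0 poly_sum_single by (simp add: hermite_const_def)

text \<open>The constants are 3/24, 9/72 and 6/72, the numerators counting pairings of equal value;
  both negative signs come from \<open>hermite_const_6\<close>.\<close>

lemma edgeworth_term_2:
  "edgeworth_term \<kappa> \<Sigma> 2 0 =
     1/8 * (\<Sum>(i1, i2, i3, i4)\<in>UNIV. \<kappa> [i1, i2, i3, i4] * g i1 i2 * g i3 i4)
     - 1/8 * (\<Sum>(i1, i2, i3, i4, i5, i6)\<in>UNIV.
         \<kappa> [i1, i2, i3] * \<kappa> [i4, i5, i6] * g i1 i2 * g i3 i4 * g i5 i6)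
     - 1/12 * (\<Sum>(i1, i2, i3, i4, i5, i6)\<in>UNIV.
         \<kappa> [i1, i2, i3] * \<kappa> [i4, i5, i6] * g i1 i4 * g i2 i5 * g i3 i6)"
proof -
  have g_commute: "g a b = g b a" for a b
    using arg_cong[OF inv_symm, of "\<lambda>M. M $ a $ b"] by (simp add: g transpose_def)
  note h = hermite_const_4[OF inv_symm g] hermite_const_6[OF inv_symm g]
  note tensor = poly_sum_scaled_tensor_poly[where w = "\<lambda>\<alpha>. hermite \<Sigma> \<alpha> 0" and h = "hermite_const g"]
  have "edgeworth_term \<kappa> \<Sigma> 2 0 =
      1/24 * (\<Sum>is | length is = 4. \<kappa> is * hermite_const g is) +
      1/72 * (\<Sum>is | length is = 6. \<kappa> (take 3 is) * \<kappa> (drop 3 is) * hermite_const g is)"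
    unfolding edgeworth_term_0 edgeworth_poly_2 poly_sum_add
    by (subst (1 2) tensor) (simp_all add: hermite_even)
  also have "(\<Sum>is | length is = 4. \<kappa> is * hermite_const g is) =
      3 * (\<Sum>(i1, i2, i3, i4)\<in>UNIV. \<kappa> [i1, i2, i3, i4] * g i1 i2 * g i3 i4)"
    unfolding sum_lists_length_4 h
    by (rule sum_contractions_4[of "\<lambda>a b c d. \<kappa> [a, b, c, d]" g]) (auto intro!: \<kappa> g_commute)
  also have "(\<Sum>is | length is = 6. \<kappa> (take 3 is) * \<kappa> (drop 3 is) * hermite_const g is) =
      - (9 * (\<Sum>(i1, i2, i3, i4, i5, i6)\<in>UNIV.
         \<kappa> [i1, i2, i3] * \<kappa> [i4, i5, i6] * g i1 i2 * g i3 i4 * g i5 i6) +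
       6 * (\<Sum>(i1, i2, i3, i4, i5, i6)\<in>UNIV.
         \<kappa> [i1, i2, i3] * \<kappa> [i4, i5, i6] * g i1 i4 * g i2 i5 * g i3 i6))"
    unfolding sum_lists_length_6 h
    by (subst sum_contractions_6[of "\<lambda>a b c. \<kappa> [a, b, c]" g, symmetric])
       (auto intro!: \<kappa> g_commute simp: case_prod_unfold sum_negf
         simp del: minus_add_distrib add_uminus_conv_diff)
  finally show ?thesis by simp
qed

lemma edgeworth_term_4:
  "edgeworth_term \<kappa> \<Sigma> 4 0 = (let h = hermite_const g in 1/720 * (\<Sum>(i1, i2, i3, i4, i5, i6)\<in>UNIV.
               \<kappa> [i1, i2, i3, i4, i5, i6] * h [i1, i2, i3, i4, i5, i6])
           + 1/720 * (\<Sum>(i1, i2, i3, i4, i5, i6, i7, i8)\<in>UNIV.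
               \<kappa> [i1, i2, i3] * \<kappa> [i4, i5, i6, i7, i8] *
               h [i1, i2, i3, i4, i5, i6, i7, i8])
           + 1/1152 * (\<Sum>(i1, i2, i3, i4, i5, i6, i7, i8)\<in>UNIV.
               \<kappa> [i1, i2, i3, i4] * \<kappa> [i5, i6, i7, i8] *
               h [i1, i2, i3, i4, i5, i6, i7, i8])
           + 1/1728 * (\<Sum>(i1, i2, i3, i4, i5, i6, i7, i8, i9, i10)\<in>UNIV.
               \<kappa> [i1, i2, i3] * \<kappa> [i4, i5, i6] * \<kappa> [i7, i8, i9, i10] *
               h [i1, i2, i3, i4, i5, i6, i7, i8, i9, i10])
           + 1/31104 * (\<Sum>(i1, i2, i3, i4, i5, i6, i7, i8, i9, i10, i11, i12)\<in>UNIV.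
               \<kappa> [i1, i2, i3] * \<kappa> [i4, i5, i6] * \<kappa> [i7, i8, i9] * \<kappa> [i10, i11, i12] *
               h [i1, i2, i3, i4, i5, i6, i7, i8, i9, i10, i11, i12]))"
proof -
  note tensor = poly_sum_scaled_tensor_poly[where w = "\<lambda>\<alpha>. hermite \<Sigma> \<alpha> 0" and h = "hermite_const g"]
  show ?thesis
    unfolding edgeworth_term_0 edgeworth_poly_4 poly_sum_add Let_def
    by (subst (1 2 3 4 5) tensor)
       (simp_all add: hermite_even sum_lists_length_6 sum_lists_length_8 sum_lists_length_10 sum_lists_length_12)
qed

end

theorem theorem2:
  fixes \<mu> :: "(real^'d) measure" and \<Theta> :: "(real^'d) set"
  assumes "natural_exponential_family \<mu> \<Theta>"
    and "full_order \<mu>"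
    and "\<And>\<theta>. \<theta> \<in> \<Theta> \<Longrightarrow> cramer_condition (nef_member \<mu> \<theta>)"
  shows "\<exists>F :: nat \<Rightarrow> real^'d \<Rightarrow> real.
    \<forall>\<theta>\<in>\<Theta>.
      (\<forall>s n. n \<ge> 1 \<longrightarrow>
         edgeworth_function \<mu> \<Theta> s n (nef_mean \<mu> \<theta>) (nef_mean \<mu> \<theta>) =
           (\<Sum>i = 0..s. F i \<theta> * real n powr (- real i))) \<and>
      (let \<kappa> = cumulant \<mu> \<theta>;
           g = fisher_inv \<mu> \<theta>;
           h = hermite_const g
       in
         F 0 \<theta> = 1 \<and>
         F 1 \<theta> =
           1/8 * (\<Sum>(i1, i2, i3, i4)\<in>UNIV. \<kappa> [i1, i2, i3, i4] * g i1 i2 * g i3 i4)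
           - 1/8 * (\<Sum>(i1, i2, i3, i4, i5, i6)\<in>UNIV.
               \<kappa> [i1, i2, i3] * \<kappa> [i4, i5, i6] * g i1 i2 * g i3 i4 * g i5 i6)
           - 1/12 * (\<Sum>(i1, i2, i3, i4, i5, i6)\<in>UNIV.
               \<kappa> [i1, i2, i3] * \<kappa> [i4, i5, i6] * g i1 i4 * g i2 i5 * g i3 i6) \<and>
         F 2 \<theta> =
           1/720 * (\<Sum>(i1, i2, i3, i4, i5, i6)\<in>UNIV.
               \<kappa> [i1, i2, i3, i4, i5, i6] * h [i1, i2, i3, i4, i5, i6])
           + 1/720 * (\<Sum>(i1, i2, i3, i4, i5, i6, i7, i8)\<in>UNIV.
               \<kappa> [i1, i2, i3] * \<kappa> [i4, i5, i6, i7, i8] *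
               h [i1, i2, i3, i4, i5, i6, i7, i8])
           + 1/1152 * (\<Sum>(i1, i2, i3, i4, i5, i6, i7, i8)\<in>UNIV.
               \<kappa> [i1, i2, i3, i4] * \<kappa> [i5, i6, i7, i8] *
               h [i1, i2, i3, i4, i5, i6, i7, i8])
           + 1/1728 * (\<Sum>(i1, i2, i3, i4, i5, i6, i7, i8, i9, i10)\<in>UNIV.
               \<kappa> [i1, i2, i3] * \<kappa> [i4, i5, i6] * \<kappa> [i7, i8, i9, i10] *
               h [i1, i2, i3, i4, i5, i6, i7, i8, i9, i10])
           + 1/31104 * (\<Sum>(i1, i2, i3, i4, i5, i6, i7, i8, i9, i10, i11, i12)\<in>UNIV.
               \<kappa> [i1, i2, i3] * \<kappa> [i4, i5, i6] * \<kappa> [i7, i8, i9] * \<kappa> [i10, i11, i12] *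
               h [i1, i2, i3, i4, i5, i6, i7, i8, i9, i10, i11, i12]))"
proof -
  interpret minimal_nef \<mu> \<Theta>
    using assms(1,2) by unfold_locales
  \<comment> \<open>At the mean the argument of every Edgeworth term is 0, so the only remaining
    dependence on \<open>n\<close> is the explicit power; the coefficients are also the same for
    every order \<open>s\<close>.\<close>
  define F where "F i \<theta> = edgeworth_term (cumulant \<mu> \<theta>) (covariance_matrix (nef_member \<mu> \<theta>)) (2 * i) 0" for i \<theta>
  have at_mean: "edgeworth_at_mean (cumulant \<mu> \<theta>) (covariance_matrix (nef_member \<mu> \<theta>)) (fisher_inv \<mu> \<theta>)"
    if "\<theta> \<in> \<Theta>" for \<theta>
  proof
    let ?\<Sigma> = "covariance_matrix (nef_member \<mu> \<theta>)"
    show "transpose (matrix_inv ?\<Sigma>) = matrix_inv ?\<Sigma>"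
      using covariance_symmetric covariance_invertible[OF that] by (rule matrix_inv_symmetric)
    show "det ?\<Sigma> \<noteq> 0"
      using covariance_invertible[OF that] invertible_det_nz by blast
    show "fisher_inv \<mu> \<theta> i j = matrix_inv ?\<Sigma> $ i $ j" for i j
      by (simp add: fisher_inv_def covariance_eq_fisher[OF that])
    show "cumulant \<mu> \<theta> is = cumulant \<mu> \<theta> js" if "mset is = mset js" for "is" js
      using that \<open>\<theta> \<in> \<Theta>\<close> by (rule cumulant_mset_cong)
  qed
  have "edgeworth_function \<mu> \<Theta> s n (nef_mean \<mu> \<theta>) (nef_mean \<mu> \<theta>) =
      (\<Sum>i = 0..s. F i \<theta> * real n powr (- real i))" if "\<theta> \<in> \<Theta>" "n \<ge> 1" for \<theta> s n
    using edgeworth_at_mean.sum_edgeworth_terms[OF at_mean[OF that(1)] that(2), of s]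
    by (simp add: edgeworth_function_def nef_param_mean[OF that(1)] F_def)
  moreover have "F 0 \<theta> = 1" if "\<theta> \<in> \<Theta>" for \<theta>
    using edgeworth_at_mean.edgeworth_term_Zero[OF at_mean[OF that]] by (simp add: F_def)
  moreover note edgeworth_at_mean.edgeworth_term_2[OF at_mean, folded F_def[of 1, simplified]]
    edgeworth_at_mean.edgeworth_term_4[OF at_mean, folded F_def[of 2, simplified]]
  ultimately show ?thesis
    by (intro exI[of _ F]) (simp add: Let_def)
qed

end
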